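(* Let $q$ be a prime power and $n\ge2$ with $\gcd(q,n)=1$, and use the notation of the context. Let $C\subset\mathbb{F}_qD_n$ be a dihedral code and write $$\mathcal{P}(C)=\bigoplus_{j=1}^{r+s}B_j,\qquad B_j=\begin{cases}A_j,&j\in J_1\\ I_j(0,1),&j\in J_2\\ I_j(1,0),&j\in J_3\\ I_j(-x_j,1),&j\in J_4\\ 0,&j\notin J_1\cup J_2\cup J_3\cup J_4,\end{cases}$$ where $0\ne x_j\in F_j$ and $J_1,J_2,J_3\subset\{1,\dots,r+s\}$, $J_4\subset\{\zeta(n)+1,\dots,r+s\}$ are pairwise disjoint, with $1\notin J_2$ if $q$ is even. Then $$\mathcal{P}(C_{ext})=\bigoplus_{j=1}^{r+s}B_j^{ext},\qquad B_j^{ext}=\begin{cases}A_j,&j\in K_1\\ I_j(0,1),&j\in K_2\\ I_j(1,0),&j\in K_3\\ 0,&j\notin K_1\cup K_2\cup K_3,\end{cases}$$ where $$K_1=J_1\cup J_4\cup\{j\in J_2\cup J_3\mid 1\le j\le r\},$$ $$K_2=\{j\in J_2\mid r+1\le j\le r+s\},\qquad K_3=\{j\in J_3\mid r+1\le j\le r+s\}.$$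
   Context: $D_n=\langle a,b\mid a^n=1,\ b^2=1,\ bab=a^{-1}\rangle$ is the dihedral group of order $2n$, $\mathbb{F}_qD_n$ its group algebra; every element is uniquely $P(a)+bQ(a)$ with $P,Q\in\mathbb{F}_q[x]$ of degree less than $n$. A dihedral code is a left ideal of $\mathbb{F}_qD_n$. $\mathbb{F}_q\langle a\rangle\subset\mathbb{F}_qD_n$ is the group algebra of the cyclic subgroup generated by $a$. Let $\mathrm{pr}_a:\mathbb{F}_qD_n\to\mathbb{F}_q\langle a\rangle$, $P(a)+bQ(a)\mapsto P(a)$. For a dihedral code $C$, $\mathrm{pr}_a(C)$ is an ideal of $\mathbb{F}_q\langle a\rangle$, and the exterior induced code is $C_{ext}=(\mathbb{F}_qD_n)\,\mathrm{pr}_a(C)$, the left ideal generated by $\mathrm{pr}_a(C)$. For $g\in\mathbb{F}_q[x]$ with $g(0)\neq0$ put $g^*(x)=x^{\deg g}g(x^{-1})$. Factor $x^n-1$ over $\mathbb{F}_q$ into (pairwise distinct) monic irreducible factors as $x^n-1=(f_1f_2\cdots f_r)(f_{r+1}f_{r+1}^*\cdots f_{r+s}f_{r+s}^* )$, where $f_1=x-1$, $f_2=x+1$ if $n$ is even, $f_j^*=f_j$ for $1<j\le r$, and for $j>r$ the polynomials $f_j$ and $f_j^*$ have different roots (here the factor $f_j^*$, $j>r$, is normalized by a scalar to be monic). Let $\alpha_j$ be a root of $f_j$. Let $\zeta(n)=1$ if $n$ is odd, $\zeta(n)=2$ if $n$ is even. $\langle h\mid h^2\rangle$ is the cyclic group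 of order 2 generated by $h$. Put $F_j=\mathbb{F}_q$ for $1\le j\le\zeta(n)$, $F_j=\mathbb{F}_q[\alpha_j+\alpha_j^{-1}]$ for $\zeta(n)+1\le j\le r$, $F_j=\mathbb{F}_q[\alpha_j]$ for $r+1\le j\le r+s$. Put $A_j=\mathbb{F}_q\langle h\mid h^2\rangle$ for $1\le j\le\zeta(n)$ and $A_j=\mathrm{M}_2(F_j)$ for $\zeta(n)+1\le j\le r+s$. Define for $u=P(a)+bQ(a)$: $\gamma_1(u)=P(1)+Q(1)h$; $\gamma_2(u)=P(-1)+Q(-1)h$ (for $n$ even); for $j\ge\zeta(n)+1$, $\tau_j(u)=\begin{pmatrix}P(\alpha_j)&Q(\alpha_j^{-1})\\ Q(\alpha_j)&P(\alpha_j^{-1})\end{pmatrix}$; for $\zeta(n)+1\le j\le r$, $\sigma_j(X)=Z_j^{-1}XZ_j$ with $Z_j=\begin{pmatrix}1&-\alpha_j\\ 1&-\alpha_j^{-1}\end{pmatrix}$. Put $\mathcal{P}_j=\gamma_j$ for $j\le\zeta(n)$, $\mathcal{P}_j=\sigma_j\tau_j$ for $\zeta(n)+1\le j\le r$, $\mathcal{P}_j=\tau_j$ for $r+1\le j\le r+s$. It is known that $\mathcal{P}=\bigoplus_{j=1}^{r+s}\mathcal{P}_j:\mathbb{F}_qD_n\to\bigoplus_{j=1}^{r+s}A_j$ is an algebra isomorphism. For $x,y\in F_j$ put $I_j(x,y)=\mathbb{F}_q\langle h\mid h^2\rangle\left[(x+y)+(x-y)h\right]$ for $1\le j\le\zeta(n)$,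 and $I_j(x,y)=\left\{\begin{pmatrix}ky & -kx \\ ty & -tx\end{pmatrix}\mid k,t\in F_j\right\}$ for $\zeta(n)+1\le j\le r+s$. Every dihedral code has an image under $\mathcal P$ of the form written in the claim. *)

theory Defs
  imports
    "HOL-Analysis.Determinants"
    "HOL-Algebra.Algebraic_Closure_Type"
    "HOL-Algebra.Elementary_Groups"
    "HOL-Algebra.Ideal"
begin

section \<open>The dihedral group and group algebras\<close>

text \<open>The pair \<open>(e, i)\<close> is the normal form \<open>b\<^sup>e a\<^sup>i\<close>, where \<open>True\<close> is the exponent 1 and
  \<open>False\<close> the exponent 0 of \<open>b\<close>. The product is
  \<open>b\<^sup>e a\<^sup>i b\<^sup>f a\<^sup>k = b\<^sup>e\<^sup>+\<^sup>f a\<^sup>\<plusminus>\<^sup>i\<^sup>+\<^sup>k\<close>, with the minus sign iff \<open>f = 1\<close>. The lemmas below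
  identify this model with the presentation \<open>\<langle>a, b | a\<^sup>n = 1, b\<^sup>2 = 1, bab = a\<^sup>-\<^sup>1\<rangle>\<close> for \<open>n \<ge> 2\<close>.\<close>

definition dihedral :: "nat \<Rightarrow> (bool \<times> int) monoid" where
  "dihedral n = \<lparr> carrier = UNIV \<times> {0..<int n},
     monoid.mult = (\<lambda>(e, i) (f, k). (e \<noteq> f, ((if f then - i else i) + k) mod int n)),
     one = (False, 0) \<rparr>"

text \<open>Elements of the group algebra of a finite group \<open>G\<close> are the functions on \<open>G\<close> (extended by 0)
  with coefficients in a subring \<open>S\<close> of the type of scalars.\<close>

definition group_algebra :: "'k::comm_ring_1 set \<Rightarrow> ('g, 'm) monoid_scheme \<Rightarrow> ('g \<Rightarrow> 'k) ring" where
  "group_algebra S G = \<lparr>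
     carrier = {u. (\<forall>g \<in> carrier G. u g \<in> S) \<and> (\<forall>g. g \<notin> carrier G \<longrightarrow> u g = 0)},
     monoid.mult = (\<lambda>u v g. \<Sum>(x, y) \<in> {(x, y). x \<in> carrier G \<and> y \<in> carrier G \<and> x \<otimes>\<^bsub>G\<^esub> y = g}. u x * v y),
     one = (\<lambda>g. if g = \<one>\<^bsub>G\<^esub> then 1 else 0),
     ring.zero = (\<lambda>_. 0),
     add = (\<lambda>u v g. u g + v g) \<rparr>"

definition left_ideal :: "'a set \<Rightarrow> ('a, 'm) ring_scheme \<Rightarrow> bool" where
  "left_ideal I R \<longleftrightarrow> additive_subgroup I R \<and> (\<forall>r \<in> carrier R. \<forall>x \<in> I. r \<otimes>\<^bsub>R\<^esub> x \<in> I)"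

definition left_ideal_gen :: "('a, 'm) ring_scheme \<Rightarrow> 'a set \<Rightarrow> 'a set" where
  "left_ideal_gen R S = \<Inter> {I. left_ideal I R \<and> S \<subseteq> I}"

type_synonym 'f dih_elem = "bool \<times> int \<Rightarrow> 'f"

abbreviation dihedral_algebra :: "nat \<Rightarrow> ('f::field dih_elem) ring" where
  "dihedral_algebra n \<equiv> group_algebra UNIV (dihedral n)"

abbreviation dihedral_code :: "nat \<Rightarrow> ('f::field dih_elem) set \<Rightarrow> bool" where
  "dihedral_code n C \<equiv> left_ideal C (dihedral_algebra n)"

text \<open>The polynomials of degree less than \<open>n\<close> with \<open>u = P(a) + bQ(a)\<close>.\<close>

definition polyP :: "nat \<Rightarrow> 'f::field dih_elem \<Rightarrow> 'f poly" where
  "polyP n u = (\<Sum>i<n. Polynomial.monom (u (False, int i)) i)"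

definition polyQ :: "nat \<Rightarrow> 'f::field dih_elem \<Rightarrow> 'f poly" where
  "polyQ n u = (\<Sum>i<n. Polynomial.monom (u (True, int i)) i)"

definition pr_a :: "'f::field dih_elem \<Rightarrow> 'f dih_elem" where
  "pr_a u = (\<lambda>(e, i). if e then 0 else u (e, i))"

definition ext_code :: "nat \<Rightarrow> ('f::field dih_elem) set \<Rightarrow> ('f dih_elem) set" where
  "ext_code n C = left_ideal_gen (dihedral_algebra n) (pr_a ` C)"


section \<open>The factorization of \<open>x\<^sup>n - 1\<close> and the components\<close>

text \<open>For \<open>g(0) \<noteq> 0\<close> the library's \<^const>\<open>reflect_poly\<close> is \<open>x\<^sup>d g(x\<^sup>-\<^sup>1)\<close> with \<open>d = deg g\<close>.\<close>

definition monic_reciprocal :: "'f::field poly \<Rightarrow> 'f poly" where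
  "monic_reciprocal g =
     Polynomial.smult (inverse (Polynomial.lead_coeff (reflect_poly g))) (reflect_poly g)"

definition \<zeta> :: "nat \<Rightarrow> nat" where
  "\<zeta> n = (if even n then 2 else 1)"

text \<open>All roots live in the algebraic closure \<open>'f alg_closure\<close> of the base field, and the base
  field is identified there with the range of \<^const>\<open>to_ac\<close>.\<close>

definition ev :: "'f::field poly \<Rightarrow> 'f alg_closure \<Rightarrow> 'f alg_closure" where
  "ev p z = poly (map_poly to_ac p) z"

definition adjoin :: "'f::field alg_closure \<Rightarrow> 'f alg_closure set" where
  "adjoin z = range (\<lambda>p. ev p z)"

definition Fj :: "nat \<Rightarrow> nat \<Rightarrow> (nat \<Rightarrow> 'f::field alg_closure) \<Rightarrow> nat \<Rightarrow> 'f alg_closure set" where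
  "Fj n r \<alpha> j =
     (if j \<le> \<zeta> n then range to_ac
      else if j \<le> r then adjoin (\<alpha> j + inverse (\<alpha> j))
      else adjoin (\<alpha> j))"

text \<open>The components of the direct sum have two different shapes, hence the sum type: the left
  summand contains the elements of \<open>\<bbbF>\<^sub>q\<langle>h | h\<^sup>2\<rangle>\<close> and the right summand matrices. The direct sum
  over \<open>j\<close> is the set of extensional functions \<^term>\<open>PiE\<close> on \<open>{1..r + s}\<close>.\<close>

type_synonym 'f component = "(int \<Rightarrow> 'f alg_closure) + ('f alg_closure ^ 2 ^ 2)"

abbreviation C2_algebra :: "(int \<Rightarrow> 'f::field alg_closure) ring" where
  "C2_algebra \<equiv> group_algebra (range to_ac) (integer_mod_group 2)"

text \<open>The element \<open>x + yh\<close>, where \<open>h\<close> is the residue class 1.\<close>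

definition C2_elem :: "'k::zero \<Rightarrow> 'k \<Rightarrow> int \<Rightarrow> 'k" where
  "C2_elem x y = (\<lambda>i. if i = 0 then x else if i = 1 then y else 0)"

definition mat2 :: "'k \<Rightarrow> 'k \<Rightarrow> 'k \<Rightarrow> 'k \<Rightarrow> 'k::zero ^ 2 ^ 2" where
  "mat2 a b c d = vector [vector [a, b], vector [c, d]]"

definition Aj :: "nat \<Rightarrow> nat \<Rightarrow> (nat \<Rightarrow> 'f::field alg_closure) \<Rightarrow> nat \<Rightarrow> 'f component set" where
  "Aj n r \<alpha> j =
     (if j \<le> \<zeta> n then Inl ` carrier C2_algebra
      else Inr ` {M. \<forall>k l. M $ k $ l \<in> Fj n r \<alpha> j})"

definition Ij :: "nat \<Rightarrow> nat \<Rightarrow> (nat \<Rightarrow> 'f::field alg_closure) \<Rightarrow> nat \<Rightarrow>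
    'f alg_closure \<Rightarrow> 'f alg_closure \<Rightarrow> 'f component set" where
  "Ij n r \<alpha> j x y =
     (if j \<le> \<zeta> n then
        Inl ` {w \<otimes>\<^bsub>C2_algebra\<^esub> C2_elem (x + y) (x - y) | w. w \<in> carrier C2_algebra}
      else
        Inr ` {mat2 (k * y) (- k * x) (t * y) (- t * x) | k t. k \<in> Fj n r \<alpha> j \<and> t \<in> Fj n r \<alpha> j})"

definition zero_component :: "nat \<Rightarrow> nat \<Rightarrow> 'f::field component set" where
  "zero_component n j = (if j \<le> \<zeta> n then {Inl \<zero>\<^bsub>C2_algebra\<^esub>} else {Inr 0})"


section \<open>The isomorphism \<open>\<P>\<close>\<close>

definition \<gamma> :: "nat \<Rightarrow> 'f::field alg_closure \<Rightarrow> 'f dih_elem \<Rightarrow> int \<Rightarrow> 'f alg_closure" where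
  "\<gamma> n z u = C2_elem (ev (polyP n u) z) (ev (polyQ n u) z)"

definition \<tau> :: "nat \<Rightarrow> 'f::field alg_closure \<Rightarrow> 'f dih_elem \<Rightarrow> 'f alg_closure ^ 2 ^ 2" where
  "\<tau> n z u = mat2 (ev (polyP n u) z) (ev (polyQ n u) (inverse z))
                  (ev (polyQ n u) z) (ev (polyP n u) (inverse z))"

definition Zmat :: "'f::field alg_closure \<Rightarrow> 'f alg_closure ^ 2 ^ 2" where
  "Zmat z = mat2 1 (- z) 1 (- inverse z)"

definition \<sigma> :: "'f::field alg_closure \<Rightarrow> 'f alg_closure ^ 2 ^ 2 \<Rightarrow> 'f alg_closure ^ 2 ^ 2" where
  "\<sigma> z M = matrix_inv (Zmat z) ** M ** Zmat z"

definition Pcomp :: "nat \<Rightarrow> nat \<Rightarrow> (nat \<Rightarrow> 'f::field alg_closure) \<Rightarrow> nat \<Rightarrow>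
    'f dih_elem \<Rightarrow> 'f component" where
  "Pcomp n r \<alpha> j u =
     (if j \<le> \<zeta> n then Inl (\<gamma> n (if j = 1 then 1 else - 1) u)
      else if j \<le> r then Inr (\<sigma> (\<alpha> j) (\<tau> n (\<alpha> j) u))
      else Inr (\<tau> n (\<alpha> j) u))"

definition Pmap :: "nat \<Rightarrow> nat \<Rightarrow> nat \<Rightarrow> (nat \<Rightarrow> 'f::field alg_closure) \<Rightarrow>
    'f dih_elem \<Rightarrow> nat \<Rightarrow> 'f component" where
  "Pmap n r s \<alpha> u = (\<lambda>j \<in> {1..r + s}. Pcomp n r \<alpha> j u)"


section \<open>The dihedral group satisfies its presentation\<close>

lemma dihedral_group:
  assumes "n \<ge> 1"
  shows "group (dihedral n)"
proof (rule groupI)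
  fix x y z assume "x \<in> carrier (dihedral n)" "y \<in> carrier (dihedral n)" "z \<in> carrier (dihedral n)"
  show "x \<otimes>\<^bsub>dihedral n\<^esub> y \<otimes>\<^bsub>dihedral n\<^esub> z = x \<otimes>\<^bsub>dihedral n\<^esub> (y \<otimes>\<^bsub>dihedral n\<^esub> z)"
    by (cases x; cases y; cases z)
      (auto simp: dihedral_def mod_simps algebra_simps)
next
  fix x assume x: "x \<in> carrier (dihedral n)"
  obtain e i where [simp]: "x = (e, i)" by (cases x)
  show "\<exists>y\<in>carrier (dihedral n). y \<otimes>\<^bsub>dihedral n\<^esub> x = \<one>\<^bsub>dihedral n\<^esub>"
    using x assms
    by (intro bexI[of _ "(e, (if e then i else - i) mod int n)"])
      (auto simp: dihedral_def mod_simps)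
qed (use assms in \<open>auto simp: dihedral_def split: prod.splits\<close>)

lemma dihedral_order: "card (carrier (dihedral n)) = 2 * n"
  by (simp add: dihedral_def card_cartesian_product)

lemma dihedral_a_pow:
  assumes "n \<ge> 2"
  shows "(False, 1) [^]\<^bsub>dihedral n\<^esub> (k :: nat) = (False, int k mod int n)"
proof -
  interpret group "dihedral n" using dihedral_group assms by simp
  show ?thesis
  proof (induction k)
    case (Suc k)
    have "(False, 1) [^]\<^bsub>dihedral n\<^esub> Suc k
        = (False, int k mod int n) \<otimes>\<^bsub>dihedral n\<^esub> (False, 1)"
      using Suc by simp
    then show ?case by (simp add: dihedral_def mod_simps add.commute)
  qed (simp add: dihedral_def)
qed

lemma dihedral_relations:
  fixes n :: nat
  assumes "n \<ge> 2"
  defines "D \<equiv> dihedral n" and "a \<equiv> (False, 1)" and "b \<equiv> (True, 0)"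
  shows "a \<in> carrier D" "b \<in> carrier D" "a [^]\<^bsub>D\<^esub> n = \<one>\<^bsub>D\<^esub>" "b \<otimes>\<^bsub>D\<^esub> b = \<one>\<^bsub>D\<^esub>"
    "b \<otimes>\<^bsub>D\<^esub> a \<otimes>\<^bsub>D\<^esub> b = inv\<^bsub>D\<^esub> a"
    "\<And>e i. i < n \<Longrightarrow> (e, int i) = (if e then b else \<one>\<^bsub>D\<^esub>) \<otimes>\<^bsub>D\<^esub> a [^]\<^bsub>D\<^esub> i"
proof -
  interpret group D unfolding D_def using dihedral_group assms by simp
  show a: "a \<in> carrier D" and b: "b \<in> carrier D" and "b \<otimes>\<^bsub>D\<^esub> b = \<one>\<^bsub>D\<^esub>"
    using assms by (auto simp: dihedral_def)
  show "a [^]\<^bsub>D\<^esub> n = \<one>\<^bsub>D\<^esub>"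
    using dihedral_a_pow[OF assms(1), of n] by (simp add: D_def a_def) (simp add: dihedral_def)
  have "b \<otimes>\<^bsub>D\<^esub> a \<otimes>\<^bsub>D\<^esub> b \<otimes>\<^bsub>D\<^esub> a = \<one>\<^bsub>D\<^esub>"
    using assms(1) by (simp add: D_def dihedral_def a_def b_def mod_simps)
  then show "b \<otimes>\<^bsub>D\<^esub> a \<otimes>\<^bsub>D\<^esub> b = inv\<^bsub>D\<^esub> a"
    using a b inv_equality by (metis m_closed)
  show "(e, int i) = (if e then b else \<one>\<^bsub>D\<^esub>) \<otimes>\<^bsub>D\<^esub> a [^]\<^bsub>D\<^esub> i" if "i < n" for e i
    using dihedral_a_pow[OF assms(1), of i] that
    by (simp add: D_def a_def b_def) (simp add: dihedral_def)
qed

end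

theory Submission
  imports Defs
begin

text \<open>Write \<open>u = P(a) + bQ(a)\<close>. The \<open>j\<close>-th component of \<open>u\<close> encodes, without loss, the values of \<open>P\<close> and
  \<open>Q\<close> at \<open>z\<close> and \<open>z\<^sup>-\<^sup>1\<close>, where \<open>z\<close> is \<open>\<alpha>\<^sub>j\<close> (or \<open>1\<close>, \<open>-1\<close> for the components of the first kind,
  \<open>j \<le> \<zeta>(n)\<close>). For \<open>v\<^sub>1, v\<^sub>2 \<in> C\<close> with polynomials \<open>P\<^sub>1, P\<^sub>2\<close> the element \<open>pr\<^sub>a(v\<^sub>1) + b pr\<^sub>a(v\<^sub>2)\<close> equals
  \<open>P\<^sub>1(a) + bP\<^sub>2(a)\<close> and lies in the exterior code. Hence the \<open>j\<close>-th component of the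
  exterior code is governed by which pairs of values \<open>(P(z), P(z\<^sup>-\<^sup>1))\<close> the elements of \<open>C\<close> attain, and since
  \<open>\<P>(C)\<close> is a direct product, this can be studied for every \<open>j\<close> separately.

  Upper bound. The values of \<open>uv\<close> at an \<open>n\<close>-th root of unity \<open>z\<close> are combinations of the values of \<open>v\<close> at
  the same \<open>z\<close> (\<open>ev_dihedral_mult\<close>). So the elements whose two polynomials vanish at prescribed
  points form a left ideal (\<open>left_ideal_vanishing\<close>), and the zero component and the two
  ideals \<open>I\<^sub>j(0,1)\<close>, \<open>I\<^sub>j(1,0)\<close> for \<open>j > r\<close> are such vanishing conditions.

  Lower bound. For \<open>j \<le> \<zeta>(n)\<close> every nonzero ideal in question contains an element with any prescribed \<open>P(z)\<close>.
  For \<open>j > r\<close> the two values are the diagonal entries of the component, and they are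
  independent in \<open>A\<^sub>j\<close> and in \<open>I\<^sub>j(-x\<^sub>j,1)\<close>, while one of them vanishes identically in \<open>I\<^sub>j(0,1)\<close> and
  \<open>I\<^sub>j(1,0)\<close>. The interesting case is \<open>\<zeta>(n) < j \<le> r\<close>. There \<open>\<alpha>\<^sub>j\<close> and \<open>\<alpha>\<^sub>j\<^sup>-\<^sup>1\<close> are conjugate, so
  \<open>P(\<alpha>\<^sub>j)\<close> determines \<open>P(\<alpha>\<^sub>j\<^sup>-\<^sup>1)\<close>. Undoing the conjugation by \<open>Z\<^sub>j\<close>, a matrix of
  \<open>I\<^sub>j(x,y)\<close> with parameters \<open>k, t\<close> has
  \<open>P(\<alpha>\<^sub>j) = (x - \<alpha>\<^sub>j\<^sup>-\<^sup>1 y)(k - \<alpha>\<^sub>j t) / (\<alpha>\<^sub>j - \<alpha>\<^sub>j\<^sup>-\<^sup>1)\<close>. As \<open>\<bbbF>\<^sub>q[\<alpha>\<^sub>j] = F\<^sub>j + \<alpha>\<^sub>j F\<^sub>j\<close>, this takes every value in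
  \<open>\<bbbF>\<^sub>q[\<alpha>\<^sub>j]\<close> as soon as \<open>(x,y) \<noteq> (0,0)\<close> (\<open>left_ideal_covers_projection\<close>), and any nonzero
  component becomes full.\<close>

section \<open>Evaluation of polynomials in the algebraic closure\<close>

lemma ev_0 [simp]: "ev 0 z = 0"
  by (simp add: ev_def)

lemma ev_pCons [simp]: "ev (pCons c p) z = to_ac c + z * ev p z"
  by (simp add: ev_def map_poly_pCons)

lemma ev_1 [simp]: "ev 1 z = 1"
  by (simp add: one_pCons)

lemma ev_add [simp]: "ev (p + q) z = ev p z + ev q z"
proof -
  have "map_poly to_ac (p + q) = map_poly to_ac p + map_poly to_ac q"
    by (intro poly_eqI) (simp add: coeff_map_poly)
  then show ?thesis by (simp add: ev_def)
qed

lemma ev_smult [simp]: "ev (Polynomial.smult c p) z = to_ac c * ev p z"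
  by (induction p) (simp_all add: algebra_simps)

lemma ev_mult [simp]: "ev (p * q) z = ev p z * ev q z"
  by (induction p) (simp_all add: algebra_simps)

lemma ev_minus [simp]: "ev (- p) z = - ev p z"
  using ev_add[of p "- p" z] by (simp add: eq_neg_iff_add_eq_0 add.commute)

lemma ev_diff [simp]: "ev (p - q) z = ev p z - ev q z"
  using ev_add[of p "- q" z] by simp

lemma ev_monom [simp]: "ev (Polynomial.monom c k) z = to_ac c * z ^ k"
  by (induction k) (simp_all add: Polynomial.monom_0 monom_Suc)

lemma ev_sum: "ev (sum p A) z = (\<Sum>i\<in>A. ev (p i) z)"
  by (induction A rule: infinite_finite_induct) simp_all

lemma ev_pcompose: "ev (pcompose p q) z = ev p (ev q z)"
  by (induction p) (simp_all add: pcompose_pCons)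

lemma ev_to_ac: "ev p (to_ac c) = to_ac (poly p c)"
  by (induction p) simp_all

lemma ev_plus_minus_1_in_base: "z = 1 \<or> z = - 1 \<Longrightarrow> ev p z \<in> range to_ac"
  by (metis ev_to_ac rangeI to_ac_1 to_ac_minus)

lemma adjoinI: "ev p z \<in> adjoin z"
  by (simp add: adjoin_def)

lemma adjoinE:
  assumes "a \<in> adjoin z"
  obtains p where "a = ev p z"
  using assms by (auto simp: adjoin_def)

lemma adjoin_closed:
  "0 \<in> adjoin z" "1 \<in> adjoin z" "z \<in> adjoin z"
  "a \<in> adjoin z \<Longrightarrow> b \<in> adjoin z \<Longrightarrow> a + b \<in> adjoin z"
  "a \<in> adjoin z \<Longrightarrow> b \<in> adjoin z \<Longrightarrow> a * b \<in> adjoin z"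
  "a \<in> adjoin z \<Longrightarrow> - a \<in> adjoin z"
  "a \<in> adjoin z \<Longrightarrow> b \<in> adjoin z \<Longrightarrow> a - b \<in> adjoin z"
proof -
  show "0 \<in> adjoin z" "1 \<in> adjoin z" "z \<in> adjoin z"
    using adjoinI[of 0 z] adjoinI[of 1 z] adjoinI[of "[:0, 1:]" z] by simp_all
  show "a + b \<in> adjoin z" "a * b \<in> adjoin z" "a - b \<in> adjoin z"
    if "a \<in> adjoin z" "b \<in> adjoin z"
    using that unfolding adjoin_def
    by (fastforce simp flip: ev_add ev_mult ev_diff)+
  show "- a \<in> adjoin z" if "a \<in> adjoin z"
    using that unfolding adjoin_def by (fastforce simp flip: ev_minus)
qed

text \<open>An element of least degree in the ideal generated by \<open>f\<close> and \<open>g\<close> divides both, so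
  irreducibility of \<open>f\<close> makes it a unit.\<close>

lemma irreducible_bezout:
  fixes f g :: "'f::field poly"
  assumes irr: "comm_semiring_1_class.irreducible f" and ndvd: "\<not> f dvd g"
  obtains u t where "u * g + t * f = 1"
proof -
  define I where "I = {m. m \<noteq> 0 \<and> (\<exists>u t. m = u * g + t * f)}"
  have "f \<noteq> 0" "f = 0 * g + 1 * f" using irr by auto
  then have "f \<in> I" unfolding I_def by blast
  define m where "m = arg_min degree (\<lambda>m. m \<in> I)"
  have m: "m \<in> I" and min: "\<And>h. h \<in> I \<Longrightarrow> degree m \<le> degree h"
    using arg_min_nat_lemma[of "\<lambda>m. m \<in> I" f degree] \<open>f \<in> I\<close> by (auto simp: m_def)
  from m obtain u t where ut: "m = u * g + t * f" and "m \<noteq> 0" by (auto simp: I_def)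
  have dvd: "m dvd h" if h: "h = u' * g + t' * f" for h u' t'
  proof (rule ccontr)
    assume "\<not> m dvd h"
    then have nz: "h mod m \<noteq> 0" by (simp add: dvd_eq_mod_eq_0)
    have "h mod m = (u' - h div m * u) * g + (t' - h div m * t) * f"
      using minus_div_mult_eq_mod[of h m] h ut by (simp add: algebra_simps)
    then have "h mod m \<in> I" using nz by (auto simp: I_def)
    then have "degree m \<le> degree (h mod m)" by (rule min)
    moreover have "degree (h mod m) < degree m"
      using degree_mod_less[of m h] \<open>m \<noteq> 0\<close> nz by auto
    ultimately show False by simp
  qed
  have "m dvd f" "m dvd g"
    using dvd[of f 0 1] dvd[of g 1 0] by simp_all
  then obtain k where k: "f = m * k" by (auto simp: dvd_def)
  have "is_unit m"
  proof (rule ccontr)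
    assume "\<not> is_unit m"
    then have "is_unit k" using irreducibleD[OF irr k] by auto
    then have "f dvd m" using k by (simp add: mult_unit_dvd_iff)
    then show False using \<open>m dvd g\<close> ndvd dvd_trans by blast
  qed
  then obtain c where "1 = m * c" by (auto simp: dvd_def)
  then have "(c * u) * g + (c * t) * f = 1" using ut by (simp add: algebra_simps)
  then show ?thesis by (rule that)
qed

text \<open>An irreducible polynomial is, up to a scalar, the minimal polynomial of each of its roots.\<close>

lemma irreducible_dvd_of_common_root:
  assumes "comm_semiring_1_class.irreducible f" "ev f z = 0" "ev g z = 0"
  shows "f dvd g"
proof (rule ccontr)
  assume "\<not> f dvd g"
  then obtain u t where "u * g + t * f = 1" using irreducible_bezout assms(1) by blast
  then have "ev (u * g + t * f) z = 1" by simp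
  then show False using assms by simp
qed

lemma adjoin_inverse:
  assumes "comm_semiring_1_class.irreducible f" "ev f z = 0" "a \<in> adjoin z"
  shows "inverse a \<in> adjoin z"
proof (cases "a = 0")
  case True
  then show ?thesis by (simp add: adjoin_closed)
next
  case False
  obtain g where g: "a = ev g z" using assms(3) by (rule adjoinE)
  have "\<not> f dvd g" using False assms(2) g by auto
  then obtain u t where "u * g + t * f = 1" using irreducible_bezout assms(1) by blast
  then have "ev (u * g + t * f) z = 1" by simp
  then have "ev u z * a = 1" using assms g by simp
  then have "inverse a = ev u z" by (metis inverse_unique mult.commute)
  then show ?thesis by (simp add: adjoinI)
qed

lemma adjoin_divide:
  assumes "comm_semiring_1_class.irreducible f" "ev f z = 0" "a \<in> adjoin z" "b \<in> adjoin z"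
  shows "a / b \<in> adjoin z"
  using adjoin_inverse[OF assms(1,2,4)] assms(3) by (simp add: divide_inverse adjoin_closed)

lemma inverse_root_of_unity:
  fixes z :: "'k::field"
  assumes "z ^ n = 1" "n \<ge> 1"
  shows "inverse z = z ^ (n - 1)" "z \<noteq> 0" "inverse z ^ n = 1"
proof -
  have "z * z ^ (n - 1) = 1" using assms by (cases n) simp_all
  then show "inverse z = z ^ (n - 1)" "z \<noteq> 0" by (auto simp: inverse_unique)
  show "inverse z ^ n = 1" using assms by (simp add: power_inverse)
qed

lemma inverse_in_adjoin:
  assumes "z ^ n = 1" "n \<ge> 1"
  shows "inverse z \<in> adjoin z"
  using inverse_root_of_unity[OF assms] adjoinI[of "Polynomial.monom 1 (n - 1)" z] by simp

text \<open>Because \<open>z\<^sup>-\<^sup>1 = z\<^sup>n\<^sup>-\<^sup>1\<close>, substituting a monomial turns a value at \<open>z\<^sup>-\<^sup>1\<close> into a value at \<open>z\<close>.\<close>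

lemma ev_inverse_in_adjoin:
  assumes "z ^ n = 1" "n \<ge> 1"
  shows "ev p (inverse z) \<in> adjoin z"
  using adjoinI[of "pcompose p (Polynomial.monom 1 (n - 1))" z]
  by (simp add: ev_pcompose inverse_root_of_unity[OF assms])

section \<open>Values at a root and at its inverse\<close>

text \<open>The situation of the components with \<open>\<zeta>(n) < j \<le> r\<close>: since \<open>z\<close> and \<open>z\<^sup>-\<^sup>1\<close> are distinct roots of one irreducible
  polynomial, \<open>p(z) \<mapsto> p(z\<^sup>-\<^sup>1)\<close> is a nontrivial automorphism of \<open>\<bbbF>\<^sub>q[z]\<close>.\<close>

locale self_reciprocal_root =
  fixes n :: nat and f :: "'f::field poly" and z :: "'f alg_closure"
  assumes n_pos: "n \<ge> 1" and root_of_unity: "z ^ n = 1"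
    and irr: "comm_semiring_1_class.irreducible f"
    and root: "ev f z = 0" and inverse_root: "ev f (inverse z) = 0"
    and neq_inverse: "z \<noteq> inverse z"
begin

text \<open>The graph of the automorphism \<open>p(z) \<mapsto> p(z\<^sup>-\<^sup>1)\<close>. As a relation it is visibly closed under the
  ring operations; \<open>conj_pair_unique\<close> below shows that it is a function.\<close>

definition conj_pair :: "'f alg_closure \<Rightarrow> 'f alg_closure \<Rightarrow> bool" where
  "conj_pair a a' \<longleftrightarrow> (\<exists>p. a = ev p z \<and> a' = ev p (inverse z))"

abbreviation F :: "'f alg_closure set" where "F \<equiv> adjoin (z + inverse z)"

lemma nonzero [simp]: "z \<noteq> 0"
  using inverse_root_of_unity root_of_unity n_pos by blast

lemma conj_pair_ev: "conj_pair (ev p z) (ev p (inverse z))"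
  by (auto simp: conj_pair_def)

lemma conj_pair_unique:
  assumes "conj_pair a a'" "conj_pair a a''"
  shows "a' = a''"
proof -
  obtain p q where pq: "a = ev p z" "a' = ev p (inverse z)" "a = ev q z" "a'' = ev q (inverse z)"
    using assms unfolding conj_pair_def by metis
  then have "f dvd p - q" using irreducible_dvd_of_common_root[OF irr root] by simp
  then have "ev (p - q) (inverse z) = 0" using inverse_root by (metis dvdE ev_mult mult_zero_left)
  then show ?thesis using pq by simp
qed

lemma conj_pair_root: "conj_pair z (inverse z)" "conj_pair (inverse z) z"
proof -
  show "conj_pair z (inverse z)" using conj_pair_ev[of "[:0, 1:]"] by simp
  have "inverse z ^ (n - 1) = z"
    using inverse_root_of_unity(1)[of "inverse z" n] inverse_root_of_unity(3)[of z n]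
      root_of_unity n_pos by simp
  then show "conj_pair (inverse z) z"
    using conj_pair_ev[of "Polynomial.monom 1 (n - 1)"]
      inverse_root_of_unity(1)[OF root_of_unity n_pos] by simp
qed

lemma conj_pair_closed:
  assumes "conj_pair a a'" "conj_pair b b'"
  shows "conj_pair (a + b) (a' + b')" "conj_pair (a - b) (a' - b')" "conj_pair (a * b) (a' * b')"
  using assms unfolding conj_pair_def by (metis ev_add ev_diff ev_mult)+

lemma conj_pair_divide:
  assumes "conj_pair a a'" "conj_pair b b'" "b \<noteq> 0"
  shows "conj_pair (a / b) (a' / b')"
proof -
  obtain g where g: "b = ev g z" "b' = ev g (inverse z)" using assms by (auto simp: conj_pair_def)
  obtain h where h: "inverse b = ev h z"
    using adjoin_inverse[OF irr root] adjoinI[of g z] g by (metis adjoinE)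
  have "conj_pair 1 (b' * ev h (inverse z))"
    using conj_pair_closed(3)[OF assms(2) conj_pair_ev[of h]] \<open>b \<noteq> 0\<close> unfolding h[symmetric] by simp
  moreover have "conj_pair 1 1" using conj_pair_ev[of 1] by simp
  ultimately have "b' * ev h (inverse z) = 1" by (rule conj_pair_unique)
  then have "inverse b' = ev h (inverse z)" by (rule inverse_unique)
  then have "conj_pair (inverse b) (inverse b')" using h conj_pair_ev by simp
  then show ?thesis using conj_pair_closed(3)[OF assms(1)] by (simp add: divide_inverse)
qed

text \<open>The automorphism exchanges \<open>z\<close> and \<open>z\<^sup>-\<^sup>1\<close>, so it fixes \<open>F = \<bbbF>\<^sub>q[z + z\<^sup>-\<^sup>1]\<close> pointwise.\<close>

lemma conj_pair_F:
  assumes "c \<in> F"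
  shows "conj_pair c c"
proof -
  obtain p where p: "c = ev p (z + inverse z)" using assms by (rule adjoinE)
  obtain q where q: "z + inverse z = ev q z" "inverse z + z = ev q (inverse z)"
    using conj_pair_closed(1)[OF conj_pair_root] by (auto simp: conj_pair_def)
  show ?thesis using conj_pair_ev[of "pcompose p q"] q by (simp add: ev_pcompose p add.commute)
qed

text \<open>\<open>\<bbbF>\<^sub>q[z] = F + zF\<close>, because \<open>z\<^sup>2 = (z + z\<^sup>-\<^sup>1)z - 1\<close>. The same coefficients serve for \<open>z\<^sup>-\<^sup>1\<close>, which satisfies the same
  quadratic equation over \<open>F\<close>.\<close>

lemma conj_pair_decomp:
  assumes "conj_pair a a'"
  obtains c e where "c \<in> F" "e \<in> F" "a = c + z * e" "a' = c + inverse z * e"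
proof -
  have "\<exists>c\<in>F. \<exists>e\<in>F. ev p z = c + z * e \<and> ev p (inverse z) = c + inverse z * e" for p
  proof (induction p)
    case 0
    show ?case by (intro bexI[of _ 0]) (simp_all add: adjoin_closed)
  next
    case (pCons b p)
    then obtain c e where ce: "c \<in> F" "e \<in> F" "ev p z = c + z * e"
      "ev p (inverse z) = c + inverse z * e" by blast
    have "to_ac b \<in> F" using adjoinI[of "[:b:]"] by simp
    then have "to_ac b - e \<in> F" "c + (z + inverse z) * e \<in> F"
      using ce by (simp_all add: adjoin_closed)
    moreover have "ev (pCons b p) z = (to_ac b - e) + z * (c + (z + inverse z) * e)"
      "ev (pCons b p) (inverse z) = (to_ac b - e) + inverse z * (c + (z + inverse z) * e)"
      using ce by (simp_all add: algebra_simps)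
    ultimately show ?case by blast
  qed
  then show ?thesis using assms that unfolding conj_pair_def by blast
qed

text \<open>For \<open>a = c + ze\<close> this quotient is the coefficient \<open>e\<close>. All entries of \<open>\<sigma>(\<tau>(u))\<close> have this
  form.\<close>

lemma conj_pair_diff_quotient:
  assumes "conj_pair a a'"
  shows "(a - a') / (z - inverse z) \<in> F"
proof -
  obtain c e where ce: "c \<in> F" "e \<in> F" "a = c + z * e" "a' = c + inverse z * e"
    using conj_pair_decomp[OF assms] by metis
  have "a - a' = (z - inverse z) * e" using ce by (simp add: algebra_simps)
  then show ?thesis using ce neq_inverse by simp
qed

end

section \<open>Two by two matrices\<close>

\<comment> \<open>leaves \<open>$\<close> to vectors and matrices\<close>
unbundle no Formal_Power_Series.fps_syntax

lemma mat2_nth [simp]: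
  "mat2 a b c d $ 1 $ 1 = a" "mat2 a b c d $ 1 $ 2 = b"
  "mat2 a b c d $ 2 $ 1 = c" "mat2 a b c d $ 2 $ 2 = d"
  by (simp_all add: mat2_def)

lemma mat2_eq_iff: "M = mat2 a b c d \<longleftrightarrow> M $ 1 $ 1 = a \<and> M $ 1 $ 2 = b \<and> M $ 2 $ 1 = c \<and> M $ 2 $ 2 = d"
  by (auto simp: vec_eq_iff forall_2)

lemma mat2_inject:
  "mat2 a b c d = mat2 a' b' c' d' \<longleftrightarrow> a = a' \<and> b = b' \<and> c = c' \<and> d = d'"
  by (auto simp: mat2_eq_iff)

lemma mat2_mult:
  "mat2 a b c d ** mat2 a' b' c' d'
    = mat2 (a * a' + b * c') (a * b' + b * d') (c * a' + d * c') (c * b' + d * (d' :: 'k::comm_semiring_1))"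
  by (simp add: mat2_eq_iff matrix_matrix_mult_def sum_2)

lemma mat2_zero: "mat2 0 0 0 0 = 0"
  by (simp add: vec_eq_iff forall_2)

lemma matrix_inv_eqI:
  fixes A B :: "'k::field ^ 'n ^ 'n"
  assumes "A ** B = mat 1" "B ** A = mat 1"
  shows "matrix_inv A = B"
proof -
  have "A ** matrix_inv A = mat 1" "matrix_inv A ** A = mat 1"
    using someI[of "\<lambda>A'. A ** A' = mat 1 \<and> A' ** A = mat 1" B] assms
    by (auto simp: matrix_inv_def)
  then show ?thesis using assms by (metis matrix_mul_assoc matrix_mul_lid matrix_mul_rid)
qed

text \<open>The determinant of \<open>Z\<close> is \<open>z - z\<^sup>-\<^sup>1\<close>.\<close>

lemma matrix_inv_Zmat:
  assumes "z \<noteq> 0" "z \<noteq> inverse z"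
  defines "d \<equiv> z - inverse z"
  shows "matrix_inv (Zmat z) = mat2 (- inverse z / d) (z / d) (- 1 / d) (1 / d)" (is "_ = ?W")
    and "Zmat z ** matrix_inv (Zmat z) = mat 1" "matrix_inv (Zmat z) ** Zmat z = mat 1"
proof -
  have d: "d \<noteq> 0" using assms by simp
  have one: "mat2 1 0 0 1 = (mat 1 :: 'a alg_closure ^ 2 ^ 2)"
    unfolding eq_commute[of "mat2 1 0 0 1"] mat2_eq_iff by (simp add: mat_def)
  have dz: "z * z = 1 + d * z"
    using \<open>z \<noteq> 0\<close> by (simp add: d_def algebra_simps)
  have ZW: "Zmat z ** ?W = mat 1"
    using d \<open>z \<noteq> 0\<close> unfolding Zmat_def mat2_mult one[symmetric]
    by (simp add: mat2_eq_iff field_simps dz)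
  have WZ: "?W ** Zmat z = mat 1"
    using d \<open>z \<noteq> 0\<close> unfolding Zmat_def mat2_mult one[symmetric]
    by (simp add: mat2_eq_iff field_simps dz)
  show W: "matrix_inv (Zmat z) = ?W" using ZW WZ by (rule matrix_inv_eqI)
  show "Zmat z ** matrix_inv (Zmat z) = mat 1" "matrix_inv (Zmat z) ** Zmat z = mat 1"
    unfolding W by (fact ZW, fact WZ)
qed

lemma \<sigma>_mat2:
  assumes "z \<noteq> 0" "z \<noteq> inverse z"
  defines "d \<equiv> z - inverse z"
  shows "\<sigma> z (mat2 p q' q p') = mat2
    ((z * (q + p') - inverse z * (p + q')) / d) ((p - p' + inverse z ^ 2 * q' - z ^ 2 * q) / d)
    ((q - q' - (p - p')) / d) ((z * (p - q) - inverse z * (p' - q')) / d)"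
proof -
  define w where "w = inverse z"
  define i where "i = inverse d"
  have zw: "z * w = 1" using \<open>z \<noteq> 0\<close> by (simp add: w_def)
  show ?thesis
    unfolding \<sigma>_def matrix_inv_Zmat(1)[OF assms(1,2), folded d_def]
    unfolding Zmat_def mat2_mult
    unfolding mat2_eq_iff mat2_nth divide_inverse w_def[symmetric] i_def[symmetric]
    by (use zw in \<open>simp add: algebra_simps power2_eq_square\<close>)
qed

text \<open>The inverse of \<open>\<sigma>\<close> in coordinates; the right-hand sides are the entries of \<open>ZMZ\<^sup>-\<^sup>1\<close>.\<close>

lemma \<sigma>_mat2_eq_iff:
  assumes "z \<noteq> 0" "z \<noteq> inverse z"
  defines "d \<equiv> z - inverse z"
  shows "\<sigma> z (mat2 p q' q p') = mat2 m11 m12 m21 m22 \<longleftrightarrow>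
    p = (m21 - m12 - inverse z * m11 + z * m22) / d \<and>
    p' = (m12 - m21 + z * m11 - inverse z * m22) / d \<and>
    q = (inverse z ^ 2 * m21 - m12 + inverse z * (m22 - m11)) / d \<and>
    q' = (m12 - z ^ 2 * m21 + z * (m11 - m22)) / d"
proof -
  define w where "w = inverse z"
  define i where "i = inverse d"
  have zw: "z * w = 1" using \<open>z \<noteq> 0\<close> by (simp add: w_def)
  note inv = matrix_inv_Zmat(2,3)[OF assms(1,2)]
  have "\<sigma> z N = M \<longleftrightarrow> N = Zmat z ** M ** matrix_inv (Zmat z)" for M N
  proof
    assume "\<sigma> z N = M"
    then have "Zmat z ** M ** matrix_inv (Zmat z)
        = (Zmat z ** matrix_inv (Zmat z)) ** N ** (Zmat z ** matrix_inv (Zmat z))"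
      unfolding \<sigma>_def by (auto simp only: matrix_mul_assoc)
    then show "N = Zmat z ** M ** matrix_inv (Zmat z)" by (simp add: inv)
  next
    assume "N = Zmat z ** M ** matrix_inv (Zmat z)"
    then have "\<sigma> z N = (matrix_inv (Zmat z) ** Zmat z) ** M ** (matrix_inv (Zmat z) ** Zmat z)"
      unfolding \<sigma>_def by (simp only: matrix_mul_assoc)
    then show "\<sigma> z N = M" by (simp add: inv)
  qed
  moreover have "Zmat z ** mat2 m11 m12 m21 m22 ** matrix_inv (Zmat z) = mat2
      ((m21 - m12 - inverse z * m11 + z * m22) / d) ((m12 - z ^ 2 * m21 + z * (m11 - m22)) / d)
      ((inverse z ^ 2 * m21 - m12 + inverse z * (m22 - m11)) / d)
      ((m12 - m21 + z * m11 - inverse z * m22) / d)"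
    unfolding matrix_inv_Zmat(1)[OF assms(1,2), folded d_def]
    unfolding Zmat_def mat2_mult
    unfolding mat2_eq_iff mat2_nth divide_inverse w_def[symmetric] i_def[symmetric]
    by (use zw in \<open>simp add: algebra_simps power2_eq_square\<close>)
  ultimately show ?thesis by (simp only: mat2_inject) blast
qed

lemma \<sigma>_eq_0_iff:
  assumes "z \<noteq> 0" "z \<noteq> inverse z"
  shows "\<sigma> z (mat2 p q' q p') = 0 \<longleftrightarrow> p = 0 \<and> p' = 0 \<and> q = 0 \<and> q' = 0"
  using \<sigma>_mat2_eq_iff[OF assms, of p q' q p' 0 0 0 0] by (simp add: mat2_zero)

section \<open>Conjugation by \<open>Z\<close> and the smaller field\<close>

context self_reciprocal_root
begin

lemma \<sigma>_conj_pair_in_F: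
  assumes "conj_pair p p'" "conj_pair q q'"
  shows "\<sigma> z (mat2 p q' q p') $ k $ l \<in> F"
proof -
  have "k \<in> {1, 2}" "l \<in> {1, 2}" using exhaust_2 by auto
  moreover have
    "(z * (q + p') - inverse z * (p + q')) / (z - inverse z) \<in> F"
    "(p - p' + inverse z ^ 2 * q' - z ^ 2 * q) / (z - inverse z) \<in> F"
    "(q - q' - (p - p')) / (z - inverse z) \<in> F"
    "(z * (p - q) - inverse z * (p' - q')) / (z - inverse z) \<in> F"
  proof -
    note c = conj_pair_closed conj_pair_root assms
    show "(z * (q + p') - inverse z * (p + q')) / (z - inverse z) \<in> F"
      using conj_pair_diff_quotient[of "z * q - inverse z * p" "inverse z * q' - z * p'"]
      by (simp add: c algebra_simps)
    show "(p - p' + inverse z ^ 2 * q' - z ^ 2 * q) / (z - inverse z) \<in> F"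
      using conj_pair_diff_quotient[of "p - z * (z * q)" "p' - inverse z * (inverse z * q')"]
      by (simp add: c algebra_simps power2_eq_square)
    show "(q - q' - (p - p')) / (z - inverse z) \<in> F"
      using conj_pair_diff_quotient[of "q - p" "q' - p'"] by (simp add: c algebra_simps)
    show "(z * (p - q) - inverse z * (p' - q')) / (z - inverse z) \<in> F"
      using conj_pair_diff_quotient[of "z * (p - q)" "inverse z * (p' - q')"]
      by (simp add: c)
  qed
  ultimately show ?thesis by (auto simp: \<sigma>_mat2 neq_inverse)
qed

text \<open>If \<open>M\<close> has entries in \<open>F\<close>, the automorphism maps \<open>Z\<close> to \<open>Z\<close> with its rows exchanged and fixes \<open>M\<close>. Hence it exchanges the
  diagonal entries of \<open>ZMZ\<^sup>-\<^sup>1\<close> as well as the off-diagonal ones, which is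
  the shape of the matrices \<open>\<tau>(u)\<close>.\<close>

lemma \<sigma>_surj_on_conj_pairs:
  assumes "m11 \<in> F" "m12 \<in> F" "m21 \<in> F" "m22 \<in> F"
  obtains g h where "\<sigma> z (mat2 (ev g z) (ev h (inverse z)) (ev h z) (ev g (inverse z)))
    = mat2 m11 m12 m21 m22"
proof -
  note c = conj_pair_closed conj_pair_root conj_pair_F[OF assms(1)] conj_pair_F[OF assms(2)]
    conj_pair_F[OF assms(3)] conj_pair_F[OF assms(4)]
  have d: "conj_pair (z - inverse z) (- (z - inverse z))" "z - inverse z \<noteq> 0"
    using conj_pair_closed(2)[OF conj_pair_root] neq_inverse by simp_all
  have "conj_pair ((m21 - m12 - inverse z * m11 + z * m22) / (z - inverse z))
    ((m21 - m12 - z * m11 + inverse z * m22) / - (z - inverse z))"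
    by (intro conj_pair_divide d c)
  moreover have "conj_pair ((inverse z * (inverse z * m21) - m12 + inverse z * (m22 - m11)) / (z - inverse z))
    ((z * (z * m21) - m12 + z * (m22 - m11)) / - (z - inverse z))"
    by (intro conj_pair_divide d c)
  ultimately obtain g h where gh:
    "ev g z = (m21 - m12 - inverse z * m11 + z * m22) / (z - inverse z)"
    "ev g (inverse z) = (m21 - m12 - z * m11 + inverse z * m22) / - (z - inverse z)"
    "ev h z = (inverse z * (inverse z * m21) - m12 + inverse z * (m22 - m11)) / (z - inverse z)"
    "ev h (inverse z) = (z * (z * m21) - m12 + z * (m22 - m11)) / - (z - inverse z)"
    unfolding conj_pair_def by metis
  have neg: "a / - b = (- a) / b" for a b :: "'f alg_closure" by simp
  show ?thesis
    by (rule that[of g h], subst \<sigma>_mat2_eq_iff)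
      (simp_all only: gh nonzero neq_inverse neg, simp_all add: power2_eq_square algebra_simps neq_inverse)
qed

lemma F_imp_adjoin:
  assumes "c \<in> F"
  shows "c \<in> adjoin z"
  using conj_pair_F[OF assms] adjoinI unfolding conj_pair_def by metis

text \<open>With \<open>e = x - z\<^sup>-\<^sup>1y\<close> the upper left entry of the unconjugated matrix is \<open>e(k - zt) / (z - z\<^sup>-\<^sup>1)\<close>. The factor \<open>e\<close> is
  nonzero since \<open>1\<close> and \<open>z\<^sup>-\<^sup>1\<close> are independent over \<open>F\<close>, and \<open>k - zt\<close> runs through all of \<open>\<bbbF>\<^sub>q[z] = F + zF\<close>.\<close>

lemma left_ideal_covers_projection:
  assumes xy: "x \<in> F" "y \<in> F" "x \<noteq> 0 \<or> y \<noteq> 0" and g: "g \<in> adjoin z"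
  obtains k t where "k \<in> F" "t \<in> F"
    "\<And>p p' q q'. \<sigma> z (mat2 p q' q p') = mat2 (k * y) (- k * x) (t * y) (- t * x) \<Longrightarrow> p = g"
proof -
  define e where "e = x - inverse z * y"
  have e: "e \<noteq> 0"
  proof
    assume "e = 0"
    then have "x = inverse z * y" by (simp add: e_def)
    moreover have "conj_pair (inverse z * y) (z * y)"
      using conj_pair_closed(3)[OF conj_pair_root(2) conj_pair_F] xy by simp
    \<comment> \<open>applying the automorphism to \<open>x = z\<^sup>-\<^sup>1y\<close>\<close>
    ultimately have "x = z * y" using conj_pair_F[OF xy(1)] conj_pair_unique by metis
    with \<open>x = inverse z * y\<close> xy(3) neq_inverse show False by auto
  qed
  have inv: "inverse z \<in> adjoin z" using inverse_in_adjoin root_of_unity n_pos by blast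
  have "e \<in> adjoin z" using xy inv by (simp add: e_def adjoin_closed F_imp_adjoin)
  moreover have "g * (z - inverse z) \<in> adjoin z" using g inv by (simp add: adjoin_closed)
  ultimately have "g * (z - inverse z) / e \<in> adjoin z" by (intro adjoin_divide[OF irr root])
  then obtain c b where cb: "c \<in> F" "b \<in> F" "g * (z - inverse z) / e = c + z * b"
    by (metis adjoinE conj_pair_ev conj_pair_decomp)
  show ?thesis
  proof (rule that[of c "- b"])
    fix p p' q q'
    assume "\<sigma> z (mat2 p q' q p') = mat2 (c * y) (- c * x) (- b * y) (- (- b) * x)"
    then have "p = (- b * y - - c * x - inverse z * (c * y) + z * (- (- b) * x)) / (z - inverse z)"
      by (subst (asm) \<sigma>_mat2_eq_iff) (simp_all add: neq_inverse)
    also have "\<dots> = (c + z * b) * e / (z - inverse z)"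
      by (simp add: e_def algebra_simps)
    also have "\<dots> = g" using e neq_inverse by (simp flip: cb(3))
    finally show "p = g" .
  qed (use cb in \<open>simp_all add: adjoin_closed\<close>)
qed

end

section \<open>Evaluating products in the dihedral group algebra\<close>

lemma ev_polyPQ:
  "ev (polyP n u) z = (\<Sum>i\<in>{0..<int n}. to_ac (u (False, i)) * z powi i)"
  "ev (polyQ n u) z = (\<Sum>i\<in>{0..<int n}. to_ac (u (True, i)) * z powi i)"
proof -
  have "(\<Sum>i<n. to_ac (u (e, int i)) * z ^ i) = (\<Sum>i\<in>{0..<int n}. to_ac (u (e, i)) * z powi i)" for e
    by (rule sum.reindex_bij_witness[where i = nat and j = int]) auto
  then show "ev (polyP n u) z = (\<Sum>i\<in>{0..<int n}. to_ac (u (False, i)) * z powi i)"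
    "ev (polyQ n u) z = (\<Sum>i\<in>{0..<int n}. to_ac (u (True, i)) * z powi i)"
    by (simp_all add: polyP_def polyQ_def ev_sum)
qed

lemma polyPQ_0: "polyP n (\<lambda>_. 0) = 0" "polyQ n (\<lambda>_. 0) = 0"
  by (simp_all add: polyP_def polyQ_def)

lemma polyPQ_add:
  "polyP n (\<lambda>g. u g + v g) = polyP n u + polyP n v"
  "polyQ n (\<lambda>g. u g + v g) = polyQ n u + polyQ n v"
  by (simp_all add: polyP_def polyQ_def flip: add_monom sum.distrib)

lemma polyPQ_minus:
  "polyP n (\<lambda>g. - u g) = - polyP n u" "polyQ n (\<lambda>g. - u g) = - polyQ n u"
  by (simp_all add: polyP_def polyQ_def minus_monom flip: sum_negf)

lemma polyPQ_pr_a: "polyP n (pr_a u) = polyP n u" "polyQ n (pr_a u) = 0"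
  by (simp_all add: polyP_def polyQ_def pr_a_def)

lemma carrier_dihedral: "carrier (dihedral n) = UNIV \<times> {0..<int n}"
  by (simp add: dihedral_def)

lemma dihedral_algebra_simps:
  "carrier (dihedral_algebra n) = {u. \<forall>g. g \<notin> carrier (dihedral n) \<longrightarrow> u g = 0}"
  "u \<oplus>\<^bsub>dihedral_algebra n\<^esub> v = (\<lambda>g. u g + v g)"
  "\<zero>\<^bsub>dihedral_algebra n\<^esub> = (\<lambda>_. 0)"
  by (auto simp: group_algebra_def)

lemma powi_mod_root_of_unity:
  fixes z :: "'k::field"
  assumes "z ^ n = 1" "n \<ge> 1"
  shows "z powi (i mod int n) = z powi i"
proof -
  have "z \<noteq> 0" using assms inverse_root_of_unity by blast
  then have "z powi i = z powi (int n * (i div int n)) * z powi (i mod int n)"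
    by (simp flip: power_int_add)
  also have "z powi (int n * (i div int n)) = 1"
    using assms by (simp add: power_int_mult)
  finally show ?thesis by simp
qed

text \<open>The functional \<open>half w e z\<close> is the value at \<open>z\<close> of \<open>P\<close> (for \<open>e = False\<close>) or \<open>Q\<close> (for \<open>e = True\<close>). Since \<open>z\<^sup>n = 1\<close>, the power \<open>z\<^sup>i\<close>
  depends only on \<open>i\<close> modulo \<open>n\<close>, and moving \<open>a\<^sup>i\<close> past \<open>b\<close> inverts it. So the convolution splits into products of
  such values, with \<open>z\<close> inverted in the left factor wherever the right factor
  contributes a \<open>b\<close>.\<close>

lemma half_evaluation_mult:
  fixes u v :: "'f::field dih_elem"
  assumes z: "z ^ n = 1" and n: "n \<ge> 1"
  defines "half \<equiv> \<lambda>w e y. \<Sum>i\<in>{0..<int n}. to_ac (w (e, i)) * (y :: 'f alg_closure) powi i"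
  shows "half (u \<otimes>\<^bsub>dihedral_algebra n\<^esub> v) e z
    = half u e z * half v False z + half u (\<not> e) (inverse z) * half v True z"
proof -
  define D where "D = (UNIV :: bool set) \<times> {0..<int n}"
  define m where "m = (\<lambda>(x, y). x \<otimes>\<^bsub>dihedral n\<^esub> y)"
  define c where "c = (\<lambda>(x, y). to_ac (u x * v y) * z powi snd (m (x, y)))"
  have m_eq: "m ((e1, i), (e2, k)) = (e1 \<noteq> e2, ((if e2 then - i else i) + k) mod int n)" for e1 i e2 k
    by (simp add: m_def dihedral_def)
  have fin: "finite (D \<times> D)" by (simp add: D_def)
  have D_sum: "sum h D = (\<Sum>e1\<in>UNIV. \<Sum>i\<in>{0..<int n}. h (e1, i))" for h :: "_ \<Rightarrow> 'f alg_closure"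
    by (simp add: D_def sum.cartesian_product)
  \<comment> \<open>the pairs of group elements whose product has \<open>b\<close>-exponent \<open>e\<close>; they are grouped by the exponent of \<open>a\<close>\<close>
  let ?S = "{p \<in> D \<times> D. fst (m p) = e}"
  have "half (u \<otimes>\<^bsub>dihedral_algebra n\<^esub> v) e z
      = (\<Sum>i\<in>{0..<int n}. \<Sum>p\<in>{p \<in> ?S. snd (m p) = i}. c p)"
    unfolding half_def
  proof (rule sum.cong[OF refl])
    fix i
    have "(u \<otimes>\<^bsub>dihedral_algebra n\<^esub> v) (e, i)
        = (\<Sum>(x, y)\<in>{p \<in> ?S. snd (m p) = i}. u x * v y)"
      unfolding group_algebra_def monoid.simps
      by (rule sum.cong) (auto simp: m_def D_def carrier_dihedral prod_eq_iff)
    then show "to_ac ((u \<otimes>\<^bsub>dihedral_algebra n\<^esub> v) (e, i)) * z powi i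
        = (\<Sum>p\<in>{p \<in> ?S. snd (m p) = i}. c p)"
      by (auto simp: to_ac_sum sum_distrib_right c_def intro!: sum.cong)
  qed
  also have "\<dots> = (\<Sum>p\<in>?S. c p)"
    by (rule sum.group) (use fin n in \<open>auto simp: m_eq D_def\<close>)
  also have "\<dots> = (\<Sum>x\<in>D. \<Sum>y\<in>D. if fst (m (x, y)) = e then c (x, y) else 0)"
    by (simp add: sum.cartesian_product sum.inter_filter fin case_prod_unfold cong: if_cong)
  also have "\<dots> = (\<Sum>e1\<in>UNIV. \<Sum>i\<in>{0..<int n}. \<Sum>e2\<in>UNIV. \<Sum>k\<in>{0..<int n}.
      if (e1 \<noteq> e2) = e then c ((e1, i), (e2, k)) else 0)"
    by (simp only: D_sum m_eq fst_conv)
  also have "\<dots> = half u e z * half v False z + half u (\<not> e) (inverse z) * half v True z"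
  proof -
    have "z \<noteq> 0" using inverse_root_of_unity z n by blast
    then have "c ((e1, i), (e2, k)) = (to_ac (u (e1, i)) * (if e2 then inverse z else z) powi i)
        * (to_ac (v (e2, k)) * z powi k)" for e1 i e2 k
      by (simp add: c_def m_eq powi_mod_root_of_unity[OF z n] power_int_add power_int_minus
          power_int_inverse)
    then show ?thesis
      by (cases e) (simp_all add: UNIV_bool half_def sum_product add.commute sum.distrib)
  qed
  finally show ?thesis .
qed

lemma ev_dihedral_mult:
  assumes "z ^ n = 1" "n \<ge> 1"
  shows "ev (polyP n (u \<otimes>\<^bsub>dihedral_algebra n\<^esub> v)) z
      = ev (polyP n u) z * ev (polyP n v) z + ev (polyQ n u) (inverse z) * ev (polyQ n v) z"
    and "ev (polyQ n (u \<otimes>\<^bsub>dihedral_algebra n\<^esub> v)) z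
      = ev (polyQ n u) z * ev (polyP n v) z + ev (polyP n u) (inverse z) * ev (polyQ n v) z"
  using half_evaluation_mult[OF assms, of u v False] half_evaluation_mult[OF assms, of u v True]
  by (simp_all add: ev_polyPQ)

lemma dihedral_algebra_mult_closed:
  assumes "n \<ge> 1"
  shows "u \<otimes>\<^bsub>dihedral_algebra n\<^esub> v \<in> carrier (dihedral_algebra n)"
proof -
  interpret group "dihedral n" using assms by (rule dihedral_group)
  have "(u \<otimes>\<^bsub>dihedral_algebra n\<^esub> v) g = 0" if "g \<notin> carrier (dihedral n)" for g
    using that by (auto simp: group_algebra_def intro!: sum.neutral)
  then show ?thesis by (simp add: dihedral_algebra_simps)
qed

text \<open>Needed because being an additive subgroup refers to the inverse of the additive monoid, an operation
  that is not a field of the ring record.\<close>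

lemma dihedral_algebra_uminus:
  fixes u :: "'f::field dih_elem"
  assumes "u \<in> carrier (dihedral_algebra n)"
  shows "inv\<^bsub>add_monoid (dihedral_algebra n)\<^esub> u = (\<lambda>g. - u g)"
proof -
  let ?G = "add_monoid (dihedral_algebra n :: 'f dih_elem ring)"
  have "group ?G"
  proof (rule groupI)
    fix w assume "w \<in> carrier ?G"
    then show "\<exists>v\<in>carrier ?G. v \<otimes>\<^bsub>?G\<^esub> w = \<one>\<^bsub>?G\<^esub>"
      by (intro bexI[of _ "\<lambda>g. - w g"]) (auto simp: dihedral_algebra_simps)
  qed (auto simp: dihedral_algebra_simps add.assoc)
  then show ?thesis
    by (rule group.inv_equality) (use assms in \<open>auto simp: dihedral_algebra_simps\<close>)
qed

definition vanishes :: "nat \<Rightarrow> 'f::field dih_elem \<Rightarrow> 'f alg_closure \<Rightarrow> bool" where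
  "vanishes n u z \<longleftrightarrow> ev (polyP n u) z = 0 \<and> ev (polyQ n u) z = 0"

text \<open>By \<open>ev_dihedral_mult\<close> both values of a product at \<open>z\<close> are combinations of the values of the
  right factor at the same point \<open>z\<close>.\<close>

lemma left_ideal_vanishing:
  fixes N :: "'f::field alg_closure set"
  assumes n: "n \<ge> 1" and N: "\<And>z. z \<in> N \<Longrightarrow> z ^ n = 1"
  shows "left_ideal {u \<in> carrier (dihedral_algebra n). \<forall>z\<in>N. vanishes n u z} (dihedral_algebra n)"
    (is "left_ideal ?I _")
  unfolding left_ideal_def
proof (intro conjI ballI)
  show "additive_subgroup ?I (dihedral_algebra n)"
  proof (intro additive_subgroupI subgroup.intro)
    fix u v assume "u \<in> ?I" "v \<in> ?I"
    then show "u \<otimes>\<^bsub>add_monoid (dihedral_algebra n)\<^esub> v \<in> ?I"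
      by (simp add: dihedral_algebra_simps vanishes_def polyPQ_add)
  next
    fix u assume u: "u \<in> ?I"
    then have "inv\<^bsub>add_monoid (dihedral_algebra n)\<^esub> u = (\<lambda>g. - u g)"
      by (intro dihedral_algebra_uminus) simp
    then show "inv\<^bsub>add_monoid (dihedral_algebra n)\<^esub> u \<in> ?I"
      using u by (simp add: dihedral_algebra_simps vanishes_def polyPQ_minus)
  qed (auto simp: dihedral_algebra_simps vanishes_def polyPQ_0)
next
  fix r u assume "u \<in> ?I"
  then show "r \<otimes>\<^bsub>dihedral_algebra n\<^esub> u \<in> ?I"
    using N n by (simp add: vanishes_def ev_dihedral_mult dihedral_algebra_mult_closed)
qed

text \<open>The element is \<open>pr\<^sub>a(v\<^sub>1) + b pr\<^sub>a(v\<^sub>2)\<close>. It lets the two polynomials of an element of the exterior code be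
  chosen independently among the first polynomials of codewords.\<close>

lemma pr_a_combination:
  fixes v1 v2 :: "'f::field dih_elem"
  assumes n: "n \<ge> 1" and C: "v1 \<in> C" "v2 \<in> C"
  obtains u where "u \<in> ext_code n C"
    "\<And>z. z ^ n = 1 \<Longrightarrow> ev (polyP n u) z = ev (polyP n v1) z"
    "\<And>z. z ^ n = 1 \<Longrightarrow> ev (polyQ n u) z = ev (polyP n v2) z"
proof -
  let ?A = "dihedral_algebra n :: 'f dih_elem ring"
  define b :: "'f dih_elem" where "b = (\<lambda>g. if g = (True, 0) then 1 else 0)"
  define u where "u = pr_a v1 \<oplus>\<^bsub>?A\<^esub> (b \<otimes>\<^bsub>?A\<^esub> pr_a v2)"
  have "polyQ n b = (\<Sum>i<n. if i = 0 then 1 else 0)"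
    unfolding polyQ_def b_def by (rule sum.cong) (simp_all add: Polynomial.monom_0 one_pCons)
  then have b: "polyP n b = 0" "polyQ n b = 1"
    using n by (simp_all add: polyP_def b_def)
  show ?thesis
  proof (rule that[of u])
    show "u \<in> ext_code n C"
      unfolding ext_code_def left_ideal_gen_def
    proof (rule InterI, clarify)
      fix I assume I: "left_ideal I ?A" "pr_a ` C \<subseteq> I"
      then have sub: "subgroup I (add_monoid ?A)"
        unfolding left_ideal_def by (blast dest: additive_subgroup.a_subgroup)
      have "b \<in> carrier ?A" using n by (auto simp: dihedral_algebra_simps b_def carrier_dihedral)
      then have "pr_a v1 \<in> I" "b \<otimes>\<^bsub>?A\<^esub> pr_a v2 \<in> I"
        using I C by (auto simp: left_ideal_def)
      then show "u \<in> I" using subgroup.m_closed[OF sub] by (simp add: u_def)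
    qed
  next
    fix z :: "'f alg_closure" assume z: "z ^ n = 1"
    show "ev (polyP n u) z = ev (polyP n v1) z" "ev (polyQ n u) z = ev (polyP n v2) z"
      by (simp_all add: u_def dihedral_algebra_simps(2) polyPQ_add ev_dihedral_mult[OF z n]
          polyPQ_pr_a b)
  qed
qed

section \<open>The group algebra of the group of order two\<close>

lemma carrier_C2: "carrier (integer_mod_group 2) = {0, 1}"
  by (auto simp: carrier_integer_mod_group)

lemma C2_elem_inject: "C2_elem a b = C2_elem c d \<longleftrightarrow> a = c \<and> b = d"
proof
  assume eq: "C2_elem a b = C2_elem c d"
  show "a = c \<and> b = d"
    using fun_cong[OF eq, of 0] fun_cong[OF eq, of 1] by (simp add: C2_elem_def)
qed simp

lemma C2_elem_0: "C2_elem 0 0 = \<zero>\<^bsub>C2_algebra\<^esub>"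
  by (auto simp: C2_elem_def group_algebra_def)

lemma C2_algebra_carrier:
  "w \<in> carrier C2_algebra \<longleftrightarrow> (\<exists>c\<in>range to_ac. \<exists>d\<in>range to_ac. w = C2_elem c d)"
  (is "?L \<longleftrightarrow> ?R")
proof
  assume ?L
  then have "w = C2_elem (w 0) (w 1)" "w 0 \<in> range to_ac" "w 1 \<in> range to_ac"
    by (auto simp: group_algebra_def carrier_C2 C2_elem_def)
  then show ?R by blast
next
  assume ?R
  then show ?L by (auto simp: group_algebra_def carrier_C2 C2_elem_def)
qed

lemma C2_elem_mult:
  "C2_elem a b \<otimes>\<^bsub>C2_algebra\<^esub> C2_elem c d = C2_elem (a * c + b * d) (a * d + b * c)"
proof
  fix g :: int
  have "{(x, y). x \<in> carrier (integer_mod_group 2) \<and> y \<in> carrier (integer_mod_group 2)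
          \<and> x \<otimes>\<^bsub>integer_mod_group 2\<^esub> y = g}
      = (if g = 0 then {(0, 0), (1, 1)} else if g = 1 then {(0, 1), (1, 0)} else {})"
    by (auto simp: carrier_C2)
  then show "(C2_elem a b \<otimes>\<^bsub>C2_algebra\<^esub> C2_elem c d) g = C2_elem (a * c + b * d) (a * d + b * c) g"
    unfolding group_algebra_def monoid.simps by (simp add: C2_elem_def)
qed

section \<open>The components of the isomorphism\<close>

text \<open>The properties of the factorization of \<open>x\<^sup>n - 1\<close> on which the three kinds of components depend: the first (\<open>j \<le> \<zeta>(n)\<close>) with the
  points \<open>1\<close> and \<open>-1\<close>, the middle (\<open>\<zeta>(n) < j \<le> r\<close>) with a self-reciprocal factor, and the last (\<open>j > r\<close>).\<close>

locale dihedral_components =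
  fixes n r s :: nat and f :: "nat \<Rightarrow> 'f::field poly" and \<alpha> :: "nat \<Rightarrow> 'f alg_closure"
  assumes n_pos: "n \<ge> 1"
    and root_of_unity: "j \<in> {1..r + s} \<Longrightarrow> \<alpha> j ^ n = 1"
    and middle_root: "\<zeta> n < j \<Longrightarrow> j \<le> r \<Longrightarrow> self_reciprocal_root n (f j) (\<alpha> j)"
    and last_irreducible: "j \<in> {r + 1..r + s} \<Longrightarrow> comm_semiring_1_class.irreducible (f j)"
    and last_root: "j \<in> {r + 1..r + s} \<Longrightarrow> ev (f j) (\<alpha> j) = 0"
    and zeta_le: "\<zeta> n \<le> r"
begin

abbreviation A where "A \<equiv> Aj n r \<alpha>"
abbreviation I where "I \<equiv> Ij n r \<alpha>"
abbreviation component where "component \<equiv> Pcomp n r \<alpha>"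

definition point :: "nat \<Rightarrow> 'f alg_closure" where
  "point j = (if j \<le> \<zeta> n then if j = 1 then 1 else - 1 else \<alpha> j)"

lemma inverse_point_first: "j \<le> \<zeta> n \<Longrightarrow> inverse (point j) = point j"
  by (simp add: point_def)

lemma point_root_of_unity:
  assumes "j \<in> {1..r + s}"
  shows "point j ^ n = 1" "inverse (point j) ^ n = 1"
proof -
  show "point j ^ n = 1"
    using assms root_of_unity by (auto simp: point_def \<zeta>_def split: if_splits)
  then show "inverse (point j) ^ n = 1" by (simp add: power_inverse)
qed

lemma component_first:
  "j \<le> \<zeta> n \<Longrightarrow> component j u = Inl (C2_elem (ev (polyP n u) (point j)) (ev (polyQ n u) (point j)))"
  by (simp add: Pcomp_def \<gamma>_def point_def)

lemma component_middle:
  "\<zeta> n < j \<Longrightarrow> j \<le> r \<Longrightarrow> component j u = Inr (\<sigma> (\<alpha> j) (mat2 (ev (polyP n u) (point j))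
     (ev (polyQ n u) (inverse (point j))) (ev (polyQ n u) (point j)) (ev (polyP n u) (inverse (point j)))))"
  by (simp add: Pcomp_def \<tau>_def point_def)

lemma component_last:
  "r < j \<Longrightarrow> component j u = Inr (mat2 (ev (polyP n u) (point j))
     (ev (polyQ n u) (inverse (point j))) (ev (polyQ n u) (point j)) (ev (polyP n u) (inverse (point j))))"
  using zeta_le by (simp add: Pcomp_def \<tau>_def point_def)

lemma component_cases [consumes 1, case_names first middle last]:
  assumes "j \<in> {1..r + s}"
  obtains "j \<le> \<zeta> n" | "\<zeta> n < j" "j \<le> r" | "r < j" "\<zeta> n < j"
  using that zeta_le by (meson le_less_trans not_le)

text \<open>For the middle components this is the statement that conjugation by \<open>Z\<^sub>j\<close> descends from \<open>\<bbbF>\<^sub>q[\<alpha>\<^sub>j]\<close> to the smaller field \<open>F\<^sub>j\<close>.\<close>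

lemma component_in_A:
  assumes j: "j \<in> {1..r + s}"
  shows "component j u \<in> A j"
  using j
proof (cases rule: component_cases)
  case first
  then have "point j = 1 \<or> point j = - 1" by (auto simp: point_def)
  then have "ev p (point j) \<in> range to_ac" for p by (rule ev_plus_minus_1_in_base)
  then have "C2_elem (ev (polyP n u) (point j)) (ev (polyQ n u) (point j)) \<in> carrier C2_algebra"
    unfolding C2_algebra_carrier by blast
  then show ?thesis using first by (simp add: component_first Aj_def)
next
  case middle
  interpret self_reciprocal_root n "f j" "\<alpha> j" using middle by (rule middle_root)
  show ?thesis
    using middle \<sigma>_conj_pair_in_F[OF conj_pair_ev conj_pair_ev]
    by (simp add: component_middle Aj_def Fj_def point_def)
next
  case last
  have "ev p (\<alpha> j) \<in> adjoin (\<alpha> j)" "ev p (inverse (\<alpha> j)) \<in> adjoin (\<alpha> j)" for p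
    using adjoinI ev_inverse_in_adjoin root_of_unity[OF j] n_pos by blast+
  then show ?thesis
    using last by (simp add: component_last Aj_def Fj_def point_def forall_2)
qed

lemma component_zero_iff:
  assumes j: "j \<in> {1..r + s}"
  shows "component j u \<in> zero_component n j
    \<longleftrightarrow> vanishes n u (point j) \<and> vanishes n u (inverse (point j))"
  using j
proof (cases rule: component_cases)
  case first
  then show ?thesis
    by (simp add: component_first zero_component_def C2_elem_inject vanishes_def inverse_point_first
        flip: C2_elem_0)
next
  case middle
  interpret self_reciprocal_root n "f j" "\<alpha> j" using middle by (rule middle_root)
  show ?thesis
    using middle by (auto simp: component_middle zero_component_def vanishes_def
        \<sigma>_eq_0_iff neq_inverse)
next
  case last
  then show ?thesis
    by (auto simp: component_last zero_component_def vanishes_def mat2_inject simp flip: mat2_zero)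
qed

text \<open>The two polynomials take their values at \<open>z\<^sup>-\<^sup>1\<close> in the second column and those at \<open>z\<close> in the first column, and \<open>I\<^sub>j(0,1)\<close>,
  \<open>I\<^sub>j(1,0)\<close> are the matrices whose second, respectively first, column is zero.\<close>

lemma component_column_iff:
  assumes j: "j \<in> {r + 1..r + s}"
  shows "component j u \<in> I j 0 1 \<longleftrightarrow> vanishes n u (inverse (point j))"
    and "component j u \<in> I j 1 0 \<longleftrightarrow> vanishes n u (point j)"
proof -
  have j': "r < j" "\<zeta> n < j" "j \<in> {1..r + s}" using j zeta_le by auto
  have vals: "ev p (point j) \<in> Fj n r \<alpha> j" "ev p (inverse (point j)) \<in> Fj n r \<alpha> j"
    "- ev p (inverse (point j)) \<in> Fj n r \<alpha> j" for p
    using adjoinI[of p "\<alpha> j"] ev_inverse_in_adjoin[of "\<alpha> j" n p] root_of_unity[OF j'(3)] n_pos j'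
    by (simp_all add: Fj_def point_def adjoin_closed)
  show "component j u \<in> I j 0 1 \<longleftrightarrow> vanishes n u (inverse (point j))"
    using j' vals by (auto simp: component_last Ij_def mat2_inject vanishes_def)
  have "Inr (mat2 (k * 0) (- k * 1) (t * 0) (- t * 1)) \<in> I j 1 0"
    if "k \<in> Fj n r \<alpha> j" "t \<in> Fj n r \<alpha> j" for k t
    using that j' unfolding Ij_def by auto
  from this[OF vals(3) vals(3), of "polyQ n u" "polyP n u"]
  show "component j u \<in> I j 1 0 \<longleftrightarrow> vanishes n u (point j)"
    using j' by (auto simp: component_last vanishes_def) (auto simp: Ij_def mat2_inject)
qed

text \<open>Some element of \<open>B\<close> forces the pair of values of the first polynomial; whether a codeword
  with this component exists is left open here and comes from the direct product decomposition of the code.\<close>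

definition attains :: "nat \<Rightarrow> 'f component set \<Rightarrow> 'f alg_closure \<Rightarrow> 'f alg_closure \<Rightarrow> bool" where
  "attains j B g g' \<longleftrightarrow> (\<exists>b\<in>B. \<forall>v. component j v = b \<longrightarrow>
     ev (polyP n v) (point j) = g \<and> ev (polyP n v) (inverse (point j)) = g')"

text \<open>The local version of the lower bound: codewords \<open>v\<^sub>1, v\<^sub>2\<close> with suitable components in \<open>B\<close> make the component of
  \<open>pr\<^sub>a(v\<^sub>1) + b pr\<^sub>a(v\<^sub>2)\<close> equal to \<open>w\<close>. The components are chosen before the codewords, so that all indices can be
  treated simultaneously.\<close>

definition extends_to :: "nat \<Rightarrow> 'f component set \<Rightarrow> 'f component \<Rightarrow> bool" where
  "extends_to j B w \<longleftrightarrow> (\<exists>b1\<in>B. \<exists>b2\<in>B. \<forall>v1 v2 u.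
     component j v1 = b1 \<longrightarrow> component j v2 = b2 \<longrightarrow>
     (\<forall>z. z ^ n = 1 \<longrightarrow> ev (polyP n u) z = ev (polyP n v1) z \<and> ev (polyQ n u) z = ev (polyP n v2) z) \<longrightarrow>
     component j u = w)"

lemma extends_toI:
  assumes "j \<in> {1..r + s}" "attains j B g g'" "attains j B h h'"
    and "\<And>u. ev (polyP n u) (point j) = g \<Longrightarrow> ev (polyP n u) (inverse (point j)) = g' \<Longrightarrow>
       ev (polyQ n u) (point j) = h \<Longrightarrow> ev (polyQ n u) (inverse (point j)) = h' \<Longrightarrow> component j u = w"
  shows "extends_to j B w"
proof -
  obtain b1 b2 where b: "b1 \<in> B" "b2 \<in> B"
    and b1: "\<And>v. component j v = b1 \<Longrightarrow>
      ev (polyP n v) (point j) = g \<and> ev (polyP n v) (inverse (point j)) = g'"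
    and b2: "\<And>v. component j v = b2 \<Longrightarrow>
      ev (polyP n v) (point j) = h \<and> ev (polyP n v) (inverse (point j)) = h'"
    using assms(2,3) unfolding attains_def by metis
  show ?thesis
    unfolding extends_to_def
  proof (rule bexI[of _ b1], rule bexI[of _ b2], intro allI impI)
    fix v1 v2 u
    assume "component j v1 = b1" "component j v2 = b2"
      and "\<forall>z. z ^ n = 1 \<longrightarrow> ev (polyP n u) z = ev (polyP n v1) z \<and> ev (polyQ n u) z = ev (polyP n v2) z"
    then show "component j u = w"
      using b1[of v1] b2[of v2] point_root_of_unity[OF assms(1)] by (intro assms(4)) auto
  qed (fact b)+
qed

text \<open>Multiplying the generators \<open>1 - h\<close> and \<open>1 + h\<close> by scalars reaches every value at \<open>z\<close>, and \<open>z = z\<^sup>-\<^sup>1\<close>.\<close>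

lemma extends_first:
  assumes j: "j \<in> {1..r + s}" "j \<le> \<zeta> n"
    and B: "B \<in> {A j, I j 0 1, I j 1 0}" and w: "w \<in> A j"
  shows "extends_to j B w"
proof -
  obtain c d where cd: "w = Inl (C2_elem c d)" "c \<in> range to_ac" "d \<in> range to_ac"
    using w j by (auto simp: Aj_def C2_algebra_carrier)
  have "attains j B e e" if e: "e \<in> range to_ac" for e
  proof -
    have e0: "C2_elem e 0 \<in> carrier C2_algebra"
      unfolding C2_algebra_carrier using e by (metis rangeI to_ac_0)
    then have "Inl (C2_elem e 0) \<in> A j" using j by (simp add: Aj_def)
    moreover have "Inl (C2_elem e (- e)) \<in> I j 0 1" "Inl (C2_elem e e) \<in> I j 1 0"
      using e0 j by (auto simp: Ij_def C2_elem_mult intro!: image_eqI exI[of _ "C2_elem e 0"])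
    ultimately obtain y where "Inl (C2_elem e y) \<in> B" using B by blast
    then show ?thesis
      unfolding attains_def using j
      by (intro bexI[of _ "Inl (C2_elem e y)"])
        (auto simp: component_first C2_elem_inject inverse_point_first)
  qed
  then show ?thesis
    using cd j by (intro extends_toI[of j B c c d d]) (auto simp: component_first)
qed

text \<open>The ideal fixes only \<open>P(\<alpha>\<^sub>j)\<close> via \<open>left_ideal_covers_projection\<close>; the value at \<open>\<alpha>\<^sub>j\<^sup>-\<^sup>1\<close> follows by conjugation. The
  full matrix algebra contains \<open>I\<^sub>j(0,1)\<close>, so the same argument covers it.\<close>

lemma extends_middle:
  assumes j: "\<zeta> n < j" "j \<le> r"
    and B: "B \<in> {A j, I j 0 1, I j 1 0} \<or> (\<exists>x\<in>Fj n r \<alpha> j. B = I j (- x) 1)" and w: "w \<in> A j"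
  shows "extends_to j B w"
proof -
  interpret self_reciprocal_root n "f j" "\<alpha> j" using j by (rule middle_root)
  have F: "Fj n r \<alpha> j = F" and pt: "point j = \<alpha> j" using j by (simp_all add: Fj_def point_def)
  obtain M :: "'f alg_closure ^ 2 ^ 2" where M: "w = Inr M" "\<And>k l. M $ k $ l \<in> F"
    using w j by (auto simp: Aj_def F)
  obtain g h where gh: "\<sigma> (\<alpha> j) (mat2 (ev g (\<alpha> j)) (ev h (inverse (\<alpha> j))) (ev h (\<alpha> j))
      (ev g (inverse (\<alpha> j)))) = M"
    using \<sigma>_surj_on_conj_pairs[OF M(2)[of 1 1] M(2)[of 1 2] M(2)[of 2 1] M(2)[of 2 2]]
    by (metis mat2_eq_iff)
  have "\<exists>x\<in>F. \<exists>y\<in>F. (x \<noteq> 0 \<or> y \<noteq> 0) \<and> I j x y \<subseteq> B"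
  proof -
    have "I j 0 1 \<subseteq> A j" using j by (auto simp: Ij_def Aj_def F forall_2 adjoin_closed)
    note A_super = this
    have F01: "0 \<in> F" "1 \<in> F" by (simp_all add: adjoin_closed)
    consider "B = A j" | "B = I j 0 1" | "B = I j 1 0" | x where "x \<in> F" "B = I j (- x) 1"
      using B unfolding F by blast
    then show ?thesis
    proof cases
      case 1
      then show ?thesis using A_super F01 by (intro bexI[of _ 0] bexI[of _ 1]) simp_all
    next
      case 2
      then show ?thesis using F01 by (intro bexI[of _ 0] bexI[of _ 1]) simp_all
    next
      case 3
      then show ?thesis using F01 by (intro bexI[of _ 1] bexI[of _ 0]) simp_all
    next
      case (4 x)
      then show ?thesis using F01 by (intro bexI[of _ "- x"] bexI[of _ 1]) (simp_all add: adjoin_closed)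
    qed
  qed
  then obtain x y where xy: "x \<in> F" "y \<in> F" "x \<noteq> 0 \<or> y \<noteq> 0" "I j x y \<subseteq> B" by blast
  have "attains j B (ev p (\<alpha> j)) (ev p (inverse (\<alpha> j)))" for p
  proof -
    obtain k t where kt: "k \<in> F" "t \<in> F"
      "\<And>a a' c c'. \<sigma> (\<alpha> j) (mat2 a c' c a') = mat2 (k * y) (- k * x) (t * y) (- t * x)
        \<Longrightarrow> a = ev p (\<alpha> j)"
      using left_ideal_covers_projection[OF xy(1-3) adjoinI] by metis
    have "Inr (mat2 (k * y) (- k * x) (t * y) (- t * x)) \<in> B"
      using xy(4) kt j by (auto simp: Ij_def F)
    then show ?thesis
      unfolding attains_def
    proof (rule bexI[rotated], intro allI impI)
      fix v assume "component j v = Inr (mat2 (k * y) (- k * x) (t * y) (- t * x))"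
      then have eq: "ev (polyP n v) (\<alpha> j) = ev p (\<alpha> j)"
        using kt(3) j by (simp add: component_middle pt)
      then have "ev (polyP n v) (inverse (\<alpha> j)) = ev p (inverse (\<alpha> j))"
        using conj_pair_ev conj_pair_unique by metis
      with eq show "ev (polyP n v) (point j) = ev p (\<alpha> j)
          \<and> ev (polyP n v) (inverse (point j)) = ev p (inverse (\<alpha> j))"
        by (simp add: pt)
    qed
  qed
  then show ?thesis
    using j gh M(1)
    by (intro extends_toI[of j B "ev g (\<alpha> j)" "ev g (inverse (\<alpha> j))" "ev h (\<alpha> j)"
          "ev h (inverse (\<alpha> j))"]) (auto simp: component_middle)
qed

text \<open>The diagonal of \<open>I\<^sub>j(-x,1)\<close> consists of all pairs \<open>(k, tx)\<close>, so \<open>x \<noteq> 0\<close> makes its entries independent.\<close>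

lemma extends_last:
  assumes j: "j \<in> {r + 1..r + s}"
    and B: "B = A j \<or> (\<exists>x\<in>Fj n r \<alpha> j. x \<noteq> 0 \<and> B = I j (- x) 1)" and w: "w \<in> A j"
  shows "extends_to j B w"
proof -
  have j': "r < j" "\<zeta> n < j" "j \<in> {1..r + s}" using j zeta_le by auto
  have F: "Fj n r \<alpha> j = adjoin (\<alpha> j)" using j' by (simp add: Fj_def)
  obtain M :: "'f alg_closure ^ 2 ^ 2" where M: "w = Inr M" "\<And>k l. M $ k $ l \<in> adjoin (\<alpha> j)"
    using w j' by (auto simp: Aj_def F)
  have "attains j B g g'" if g: "g \<in> adjoin (\<alpha> j)" "g' \<in> adjoin (\<alpha> j)" for g g'
  proof -
    have "\<exists>c d. Inr (mat2 g c d g') \<in> B"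
      using B
    proof
      assume "B = A j"
      then have "Inr (mat2 g 0 0 g') \<in> B"
        using g j' by (simp add: Aj_def F forall_2 adjoin_closed)
      then show ?thesis by blast
    next
      assume "\<exists>x\<in>Fj n r \<alpha> j. x \<noteq> 0 \<and> B = I j (- x) 1"
      then obtain x where x: "x \<in> adjoin (\<alpha> j)" "x \<noteq> 0" "B = I j (- x) 1" by (auto simp: F)
      have "g' / x \<in> adjoin (\<alpha> j)"
        using last_irreducible last_root j g x by (intro adjoin_divide)
      then have "mat2 (g * 1) (- g * - x) (g' / x * 1) (- (g' / x) * - x)
          \<in> {mat2 (k * 1) (- k * - x) (t * 1) (- t * - x) |k t. k \<in> adjoin (\<alpha> j) \<and> t \<in> adjoin (\<alpha> j)}"
        using g by blast
      moreover have "B = Inr ` {mat2 (k * 1) (- k * - x) (t * 1) (- t * - x) |k t.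
          k \<in> adjoin (\<alpha> j) \<and> t \<in> adjoin (\<alpha> j)}"
        using j' x(3) by (simp add: Ij_def F)
      ultimately have "Inr (mat2 (g * 1) (- g * - x) (g' / x * 1) (- (g' / x) * - x)) \<in> B"
        by blast
      then show ?thesis using x by auto
    qed
    then obtain c d where "Inr (mat2 g c d g') \<in> B" by blast
    then show ?thesis
      unfolding attains_def using j'
      by (intro bexI[of _ "Inr (mat2 g c d g')"]) (auto simp: component_last mat2_inject)
  qed
  moreover have "w = Inr (mat2 (M $ 1 $ 1) (M $ 1 $ 2) (M $ 2 $ 1) (M $ 2 $ 2))"
    unfolding M(1) sum.inject mat2_eq_iff by simp
  ultimately show ?thesis
    using M(2) j' by (intro extends_toI[of j B "M $ 1 $ 1" "M $ 2 $ 2" "M $ 2 $ 1" "M $ 1 $ 2"])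
      (simp_all add: component_last)
qed

lemma extends_columns:
  assumes j: "j \<in> {r + 1..r + s}"
  shows "w \<in> I j 0 1 \<Longrightarrow> extends_to j (I j 0 1) w"
    and "w \<in> I j 1 0 \<Longrightarrow> extends_to j (I j 1 0) w"
proof -
  have j': "r < j" "\<zeta> n < j" "j \<in> {1..r + s}" using j zeta_le by auto
  have F: "0 \<in> Fj n r \<alpha> j" using j' by (simp add: Fj_def adjoin_closed)
  show "extends_to j (I j 0 1) w" if w: "w \<in> I j 0 1"
  proof -
    obtain k t where kt: "w = Inr (mat2 k 0 t 0)" "k \<in> Fj n r \<alpha> j" "t \<in> Fj n r \<alpha> j"
      using w j' by (auto simp: Ij_def)
    have "attains j (I j 0 1) e 0" if "e \<in> Fj n r \<alpha> j" for e
      unfolding attains_def using j' that F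
      by (intro bexI[of _ "Inr (mat2 e 0 0 0)"]) (auto simp: component_last mat2_inject Ij_def)
    then show ?thesis
      using kt j' by (intro extends_toI[of j _ k 0 t 0]) (auto simp: component_last)
  qed
  show "extends_to j (I j 1 0) w" if w: "w \<in> I j 1 0"
  proof -
    obtain k t where kt: "w = Inr (mat2 0 (- k) 0 (- t))" "k \<in> Fj n r \<alpha> j" "t \<in> Fj n r \<alpha> j"
      using w j' by (auto simp: Ij_def)
    have "attains j (I j 1 0) 0 (- e)" if "e \<in> Fj n r \<alpha> j" for e
      unfolding attains_def using j' that F
      by (intro bexI[of _ "Inr (mat2 0 0 0 (- e))"]) (auto simp: component_last mat2_inject Ij_def)
    then show ?thesis
      using kt j' by (intro extends_toI[of j _ 0 "- t" 0 "- k"]) (auto simp: component_last)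
  qed
qed

lemma extends_zero:
  assumes j: "j \<in> {1..r + s}" and w: "w \<in> zero_component n j"
  shows "extends_to j (zero_component n j) w"
proof (rule extends_toI[OF j, of _ 0 0 0 0])
  show "attains j (zero_component n j) 0 0"
    unfolding attains_def using w component_zero_iff[OF j]
    by (intro bexI[of _ w]) (auto simp: vanishes_def)
  then show "attains j (zero_component n j) 0 0" .
  fix u assume "ev (polyP n u) (point j) = 0" "ev (polyP n u) (inverse (point j)) = 0"
    "ev (polyQ n u) (point j) = 0" "ev (polyQ n u) (inverse (point j)) = 0"
  then have "component j u \<in> zero_component n j" using component_zero_iff[OF j] by (simp add: vanishes_def)
  then show "component j u = w" using w by (auto simp: zero_component_def split: if_splits)
qed

end

section \<open>The exterior induced code\<close>

text \<open>Used to see that \<open>1\<close> and \<open>-1\<close> are roots of no factor beyond the first \<open>\<zeta>(n)\<close> ones, which gives \<open>\<alpha>\<^sub>j \<noteq> \<alpha>\<^sub>j\<^sup>-\<^sup>1\<close> in the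
  middle range.\<close>

lemma monic_irreducible_eq_linear:
  fixes g :: "'f::field poly"
  assumes "comm_semiring_1_class.irreducible g" "Polynomial.lead_coeff g = 1"
    "ev g (to_ac c) = 0"
  shows "g = [:- c, 1:]"
proof -
  have "g dvd [:- c, 1:]"
    using assms by (intro irreducible_dvd_of_common_root[of _ "to_ac c"]) simp_all
  then obtain h where h: "[:- c, 1:] = g * h" by (auto simp: dvd_def)
  have "poly g c = 0" using assms(3) by (simp add: ev_to_ac)
  then obtain k where k: "g = [:- c, 1:] * k" by (auto simp: poly_eq_0_iff_dvd dvd_def)
  have "[:- c, 1:] * 1 = [:- c, 1:] * (k * h)" using h k by (simp only: mult.assoc mult_1_right)
  then have "k * h = 1" by (metis mult_cancel_left pCons_eq_0_iff one_neq_zero)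
  then have "k dvd 1" by (metis dvd_triv_left)
  then obtain e where e: "k = [:e:]" by (auto simp: is_unit_poly_iff)
  have "Polynomial.lead_coeff g = e" unfolding k e by (subst lead_coeff_mult) simp
  then show ?thesis using assms(2) by (simp add: k e)
qed

theorem theorem7:
  fixes n r s :: nat
    and f :: "nat \<Rightarrow> 'f::{field, finite} poly"
    and \<alpha> x :: "nat \<Rightarrow> 'f alg_closure"
    and C :: "(bool \<times> int \<Rightarrow> 'f) set"
    and J1 J2 J3 J4 K1 K2 K3 :: "nat set"
  assumes n: "n \<ge> 2" and coprime: "coprime CARD('f) n"
    \<comment> \<open>the factorization of \<open>x\<^sup>n - 1\<close>\<close>
    and fact: "Polynomial.monom 1 n - 1
      = (\<Prod>j = 1..r. f j) * (\<Prod>j = r + 1..r + s. f j * monic_reciprocal (f j))"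
    and irred: "\<And>j. j \<in> {1..r + s} \<Longrightarrow>
      comm_semiring_1_class.irreducible (f j) \<and> Polynomial.lead_coeff (f j) = 1"
    and dist: "distinct (map f [1..<r + s + 1] @ map (\<lambda>j. monic_reciprocal (f j)) [r + 1..<r + s + 1])"
    and zeta_le: "\<zeta> n \<le> r"
    and f1: "f 1 = [:- 1, 1:]" and f2: "even n \<Longrightarrow> f 2 = [:1, 1:]"
    and self_rec: "\<And>j. 1 < j \<Longrightarrow> j \<le> r \<Longrightarrow> reflect_poly (f j) = f j"
    and non_self_rec: "\<And>j. j \<in> {r + 1..r + s} \<Longrightarrow>
      {z. ev (f j) z = 0} \<inter> {z. ev (reflect_poly (f j)) z = 0} = {}"
    and root: "\<And>j. j \<in> {1..r + s} \<Longrightarrow> ev (f j) (\<alpha> j) = 0"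
    \<comment> \<open>the code and its decomposition\<close>
    and code: "dihedral_code n C"
    and J_sub: "J1 \<subseteq> {1..r + s}" "J2 \<subseteq> {1..r + s}" "J3 \<subseteq> {1..r + s}" "J4 \<subseteq> {\<zeta> n + 1..r + s}"
    and J_disj: "J1 \<inter> J2 = {}" "J1 \<inter> J3 = {}" "J1 \<inter> J4 = {}" "J2 \<inter> J3 = {}" "J2 \<inter> J4 = {}" "J3 \<inter> J4 = {}"
    and J2_even: "even CARD('f) \<Longrightarrow> 1 \<notin> J2"
    and x: "\<And>j. j \<in> J4 \<Longrightarrow> x j \<in> Fj n r \<alpha> j \<and> x j \<noteq> 0"
    and decomp: "Pmap n r s \<alpha> ` C = (\<Pi>\<^sub>E j \<in> {1..r + s}.
      if j \<in> J1 then Aj n r \<alpha> j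
      else if j \<in> J2 then Ij n r \<alpha> j 0 1
      else if j \<in> J3 then Ij n r \<alpha> j 1 0
      else if j \<in> J4 then Ij n r \<alpha> j (- x j) 1
      else zero_component n j)"
    and K1: "K1 = J1 \<union> J4 \<union> {j \<in> J2 \<union> J3. 1 \<le> j \<and> j \<le> r}"
    and K2: "K2 = {j \<in> J2. r + 1 \<le> j \<and> j \<le> r + s}"
    and K3: "K3 = {j \<in> J3. r + 1 \<le> j \<and> j \<le> r + s}"
  shows "Pmap n r s \<alpha> ` ext_code n C = (\<Pi>\<^sub>E j \<in> {1..r + s}.
      if j \<in> K1 then Aj n r \<alpha> j
      else if j \<in> K2 then Ij n r \<alpha> j 0 1
      else if j \<in> K3 then Ij n r \<alpha> j 1 0
      else zero_component n j)"
proof -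
  have n1: "n \<ge> 1" using n by simp
  have roots: "\<alpha> j ^ n = 1" if j: "j \<in> {1..r + s}" for j
  proof -
    have "f j dvd Polynomial.monom 1 n - 1"
    proof (cases "j \<le> r")
      case True
      then have "f j dvd (\<Prod>j = 1..r. f j)" using j by (intro dvd_prodI) auto
      then show ?thesis unfolding fact by (rule dvd_mult2)
    next
      case False
      then have "f j * monic_reciprocal (f j) dvd (\<Prod>j = r + 1..r + s. f j * monic_reciprocal (f j))"
        using j by (intro dvd_prodI) auto
      then show ?thesis unfolding fact by (meson dvd_mult dvd_mult_left)
    qed
    then have "ev (Polynomial.monom 1 n - 1) (\<alpha> j) = 0"
      using root[OF j] by (metis dvdE ev_mult mult_zero_left)
    then show ?thesis by simp
  qed
  have f_inj: "i = j" if "f i = f j" "i \<in> {1..r + s}" "j \<in> {1..r + s}" for i j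
  proof -
    have "inj_on f (set [1..<r + s + 1])"
      using dist by (simp only: distinct_append distinct_map)
    moreover have "set [1..<r + s + 1] = {1..r + s}" by auto
    ultimately have "inj_on f {1..r + s}" by (simp only:)
    then show ?thesis using that by (auto dest: inj_onD)
  qed
  have middle: "self_reciprocal_root n (f j) (\<alpha> j)" if j: "\<zeta> n < j" "j \<le> r" for j
  proof
    have j1: "1 < j" "j \<in> {1..r + s}" using j by (auto simp: \<zeta>_def split: if_splits)
    show "n \<ge> 1" "\<alpha> j ^ n = 1" "comm_semiring_1_class.irreducible (f j)" "ev (f j) (\<alpha> j) = 0"
      using n1 roots irred root j1 by auto
    have nz: "\<alpha> j \<noteq> 0" using inverse_root_of_unity(2)[OF roots n1] j1 by blast
    have "map_poly to_ac (reflect_poly (f j)) = reflect_poly (map_poly to_ac (f j))"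
      by (rule poly_eqI) (simp add: coeff_map_poly coeff_reflect_poly degree_map_poly)
    then have "ev (reflect_poly (f j)) (inverse (\<alpha> j)) = 0"
      using nz root[OF j1(2)] by (simp add: ev_def poly_reflect_poly_nz)
    then show "ev (f j) (inverse (\<alpha> j)) = 0" using self_rec j1 j by simp
    have linear: "f j = [:- c, 1:]" if "\<alpha> j = to_ac c" for c
      using monic_irreducible_eq_linear[of "f j" c] irred[OF j1(2)] root[OF j1(2)] by (simp add: that)
    show "\<alpha> j \<noteq> inverse (\<alpha> j)"
    proof
      assume "\<alpha> j = inverse (\<alpha> j)"
      then have "\<alpha> j ^ 2 = 1" using nz by (metis power2_eq_square right_inverse)
      then consider "\<alpha> j = 1" | "\<alpha> j = - 1" by (auto simp: power2_eq_1_iff)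
      then show False
      proof cases
        case 1
        then have "f j = f 1"
          using linear[of 1] f1 by simp
        then show False using f_inj[of j 1] j1 by auto
      next
        case 2
        then have fj: "f j = [:1, 1:]"
          using linear[of "- 1"] by simp
        show False
        proof (cases "even n")
          case True
          then show False using f_inj[of j 2] fj f2 j1 j by (auto simp: \<zeta>_def)
        next
          case False
          \<comment> \<open>here \<open>- 1\<close> is an \<open>n\<close>-th root of unity with \<open>n\<close> odd, which forces \<open>- 1 = 1\<close>\<close>
          then have "(- 1 :: 'f alg_closure) = 1" using roots[OF j1(2)] 2 by simp
          then have "to_ac (- 1 :: 'f) = to_ac 1" by simp
          then have "(- 1 :: 'f) = 1" by (simp only: to_ac_eq_iff)
          then have "f j = f 1" using fj f1 by simp
          then show False using f_inj[of j 1] j1 by auto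
        qed
      qed
    qed
  qed
  interpret dihedral_components n r s f \<alpha>
    by (rule dihedral_components.intro) (use n1 roots middle irred root zeta_le in auto)
  define B where "B j = (if j \<in> J1 then A j else if j \<in> J2 then I j 0 1
    else if j \<in> J3 then I j 1 0 else if j \<in> J4 then I j (- x j) 1 else zero_component n j)" for j
  define E where "E j = (if j \<in> K1 then A j else if j \<in> K2 then I j 0 1
    else if j \<in> K3 then I j 1 0 else zero_component n j)" for j
  \<comment> \<open>the points at which the elements of the exterior code are forced to vanish by their \<open>j\<close>-th component\<close>
  define N where "N j = (if j \<in> K1 then {} else if j \<in> K2 then {inverse (point j)}
    else if j \<in> K3 then {point j} else {point j, inverse (point j)})" for j
  have decomp': "Pmap n r s \<alpha> ` C = (\<Pi>\<^sub>E j \<in> {1..r + s}. B j)"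
    unfolding decomp B_def ..
  have in_B: "component j v \<in> B j" if "v \<in> C" "j \<in> {1..r + s}" for v j
  proof -
    have "Pmap n r s \<alpha> v \<in> (\<Pi>\<^sub>E j \<in> {1..r + s}. B j)" using that decomp' by blast
    then show ?thesis using that by (auto simp: Pmap_def dest: PiE_mem)
  qed
  have in_E: "component j u \<in> E j" if "j \<in> {1..r + s}" "\<forall>z\<in>N j. vanishes n u z" for j u
    using that component_in_A[of j u] component_column_iff[of j u] component_zero_iff[of j u] K2 K3
    by (auto simp: E_def N_def)
  have "ext_code n C \<subseteq> {u \<in> carrier (dihedral_algebra n). \<forall>z\<in>\<Union>j\<in>{1..r + s}. N j. vanishes n u z}"
    (is "_ \<subseteq> ?V")
    unfolding ext_code_def left_ideal_gen_def
  proof (intro Inter_lower CollectI conjI image_subsetI ballI)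
    show "left_ideal ?V (dihedral_algebra n)"
      using n1 point_root_of_unity by (intro left_ideal_vanishing) (auto simp: N_def split: if_splits)
  next
    fix v assume v: "v \<in> C"
    have "C \<subseteq> carrier (dihedral_algebra n)"
      using code additive_subgroup.a_subset unfolding left_ideal_def by blast
    then show "pr_a v \<in> carrier (dihedral_algebra n)"
      using v by (auto simp: dihedral_algebra_simps pr_a_def)
    fix z assume "z \<in> (\<Union>j\<in>{1..r + s}. N j)"
    then obtain j where j: "j \<in> {1..r + s}" and z: "z \<in> N j" by blast
    have "ev (polyP n v) z = 0"
      using z in_B[OF v j] component_column_iff[of j v] component_zero_iff[OF j, of v] K1 K2 K3 J_disj j
      by (auto simp: B_def N_def vanishes_def split: if_splits)
    then show "vanishes n (pr_a v) z" by (simp add: vanishes_def polyPQ_pr_a)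
  qed
  then have "Pmap n r s \<alpha> ` ext_code n C \<subseteq> (\<Pi>\<^sub>E j \<in> {1..r + s}. E j)"
    using in_E by (fastforce simp: Pmap_def)
  moreover have "(\<Pi>\<^sub>E j \<in> {1..r + s}. E j) \<subseteq> Pmap n r s \<alpha> ` ext_code n C"
  proof
    fix w assume w: "w \<in> (\<Pi>\<^sub>E j \<in> {1..r + s}. E j)"
    have "extends_to j (B j) (w j)" if j: "j \<in> {1..r + s}" for j
    proof -
      have wj: "w j \<in> E j" using w j by (auto dest: PiE_mem)
      consider "j \<in> K1" | "j \<in> K2" "j \<notin> K1" | "j \<in> K3" "j \<notin> K1" "j \<notin> K2"
        | "j \<notin> K1" "j \<notin> K2" "j \<notin> K3" by blast
      then show ?thesis
      proof cases
        case 1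
        then have w_A: "w j \<in> A j" using wj by (simp add: E_def)
        from j show ?thesis
        proof (cases rule: component_cases)
          case first
          then have "j \<notin> J4" using J_sub(4) by auto
          then have "B j \<in> {A j, I j 0 1, I j 1 0}" using 1 by (auto simp: B_def K1)
          then show ?thesis using first w_A j by (intro extends_first)
        next
          case middle
          have "B j \<in> {A j, I j 0 1, I j 1 0} \<or> (\<exists>x\<in>Fj n r \<alpha> j. B j = I j (- x) 1)"
            using 1 x[of j] by (auto simp: B_def K1)
          then show ?thesis using middle w_A by (intro extends_middle)
        next
          case last
          then have "B j = A j \<or> (\<exists>x\<in>Fj n r \<alpha> j. x \<noteq> 0 \<and> B j = I j (- x) 1)"
            using 1 J_disj x[of j] by (auto simp: B_def K1)
          then show ?thesis using last j w_A by (intro extends_last) auto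
        qed
      next
        case 2
        then have "B j = I j 0 1" "E j = I j 0 1" "j \<in> {r + 1..r + s}"
          using J_disj by (auto simp: B_def E_def K2)
        then show ?thesis using wj extends_columns(1) by simp
      next
        case 3
        then have "B j = I j 1 0" "E j = I j 1 0" "j \<in> {r + 1..r + s}"
          using J_disj by (auto simp: B_def E_def K3)
        then show ?thesis using wj extends_columns(2) by simp
      next
        case 4
        then have "j \<notin> J1" "j \<notin> J4" "j \<notin> J2" "j \<notin> J3"
          using j unfolding K1 K2 K3 by (cases "j \<le> r"; simp)+
        then have "B j = zero_component n j" "E j = zero_component n j"
          using 4 by (simp_all add: B_def E_def)
        then show ?thesis using wj j extends_zero by simp
      qed
    qed
    then obtain b1 b2 where b: "\<And>j. j \<in> {1..r + s} \<Longrightarrow> b1 j \<in> B j \<and> b2 j \<in> B j"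
      "\<And>j v1 v2 u. j \<in> {1..r + s} \<Longrightarrow> component j v1 = b1 j \<Longrightarrow> component j v2 = b2 j \<Longrightarrow>
        \<forall>z. z ^ n = 1 \<longrightarrow> ev (polyP n u) z = ev (polyP n v1) z \<and> ev (polyQ n u) z = ev (polyP n v2) z
        \<Longrightarrow> component j u = w j"
      unfolding extends_to_def Bex_def by metis
    have "\<exists>v\<in>C. Pmap n r s \<alpha> v = restrict b {1..r + s}" if "\<And>j. j \<in> {1..r + s} \<Longrightarrow> b j \<in> B j" for b
      using that decomp' restrict_PiE_iff[of b "{1..r + s}" B] by (metis (no_types, lifting) imageE)
    then obtain v1 v2 where v: "v1 \<in> C" "v2 \<in> C"
      "Pmap n r s \<alpha> v1 = restrict b1 {1..r + s}" "Pmap n r s \<alpha> v2 = restrict b2 {1..r + s}"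
      using b(1) by metis
    obtain u where u: "u \<in> ext_code n C"
      "\<And>z. z ^ n = 1 \<Longrightarrow> ev (polyP n u) z = ev (polyP n v1) z"
      "\<And>z. z ^ n = 1 \<Longrightarrow> ev (polyQ n u) z = ev (polyP n v2) z"
      using pr_a_combination[OF n1 v(1,2)] by metis
    have "component j u = w j" if j: "j \<in> {1..r + s}" for j
    proof (rule b(2)[OF j])
      show "component j v1 = b1 j" "component j v2 = b2 j"
        using fun_cong[OF v(3), of j] fun_cong[OF v(4), of j] j by (simp_all add: Pmap_def)
    qed (use u in blast)
    moreover have "w \<in> extensional {1..r + s}" using w by (simp add: PiE_iff)
    ultimately have "Pmap n r s \<alpha> u = w"
      unfolding Pmap_def by (intro extensionalityI[of _ "{1..r + s}"]) simp_all
    then show "w \<in> Pmap n r s \<alpha> ` ext_code n C" using u(1) by blast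
  qed
  ultimately have "Pmap n r s \<alpha> ` ext_code n C = (\<Pi>\<^sub>E j \<in> {1..r + s}. E j)" by (rule subset_antisym)
  then show ?thesis unfolding E_def .
qed

end
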